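(* Let $p$ be a prime, $d\ge 1$, and let $f\in\mathbb{Z}[\mathbb{Z}^d]=\mathbb{Z}[t_1^{\pm1},\dots,t_d^{\pm1}]$ be a Laurent polynomial which does not vanish at any point of the $p$-adic $d$-torus $T_p^d$. Then for every sequence $\Gamma_n\to 0$ of subgroups of $\Gamma=\mathbb{Z}^d$ the $p$-adic entropy $h_p(f)$ of the $\mathbb{Z}^d$-action on $X_f$ exists, and \[ h_p(f)=m_p(f):=\int_{T_p^d}\log_p f(z), \] where the right-hand side is the Snirelman integral.
   Context: Let $\mathbb{C}_p$ be the completion of an algebraic closure $\overline{\mathbb{Q}}_p$ of $\mathbb{Q}_p$, and $T_p^d=\{z\in\mathbb{C}_p^d : |z_i|_p=1 \text{ for all } i\}$. Let $\log_p:\mathbb{C}_p^*\to\mathbb{C}_p$ be the branch of the $p$-adic logarithm normalized by $\log_p(p)=0$. The Snirelman integral of a continuous $F:T_p^d\to\mathbb{C}_p$ is $\int_{T_p^d}F(z):=\lim_{N\to\infty,\,(N,p)=1}N^{-d}\sum_{\zeta\in\mu_N^d}F(\zeta)$, where $\mu_N\subset\overline{\mathbb{Q}}_p^*$ is the group of $N$-th roots of unity. For a countable discrete group $\Gamma$ and $f=\sum_\gamma a_\gamma\gamma\in\mathbb{Z}\Gamma$ ($a_\gamma\in\mathbb{Z}$, almost all zero; for $\Gamma=\mathbb{Z}^d$ this is identified with a Laurent polynomial via $\nu\mapsto t^\nu$), $X_f\subset(\mathbb{R}/\mathbb{Z})^\Gamma$ is the closed subgroup of all $(x_{\gamma'})_{\gamma'\in\Gamma}$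 with $\sum_{\gamma'}x_{\gamma'}a_{\gamma^{-1}\gamma'}=0$ in $\mathbb{R}/\mathbb{Z}$ for all $\gamma\in\Gamma$; $\Gamma$ acts by $\gamma\cdot(x_{\gamma'})=(x_{\gamma^{-1}\gamma'})$. For a subgroup $N$, $\mathrm{Fix}_N(X_f)$ is the set of points of $X_f$ fixed by every element of $N$. A sequence $\Gamma_n\to e$ (written $\Gamma_n\to 0$ for $\Gamma=\mathbb{Z}^d$) is a sequence of normal subgroups of finite index in $\Gamma$ such that only the neutral element lies in infinitely many $\Gamma_n$. The $p$-adic entropy with respect to $(\Gamma_n)$ is $h_p(f):=\lim_{n\to\infty}\frac{1}{(\Gamma:\Gamma_n)}\log_p|\mathrm{Fix}_{\Gamma_n}(X_f)|$ (limit in $\mathbb{Q}_p$), when the sets are finite and the limit exists. *)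

theory Defs
  imports "HOL-Analysis.Analysis" "HOL-Computational_Algebra.Polynomial"
begin

definition av_lim :: "('k::field \<Rightarrow> real) \<Rightarrow> (nat \<Rightarrow> 'k) \<Rightarrow> 'k \<Rightarrow> bool" where
  "av_lim av X L \<longleftrightarrow> (\<forall>\<epsilon>>0. \<exists>M. \<forall>n\<ge>M. av (X n - L) < \<epsilon>)"

definition av_cauchy :: "('k::field \<Rightarrow> real) \<Rightarrow> (nat \<Rightarrow> 'k) \<Rightarrow> bool" where
  "av_cauchy av X \<longleftrightarrow> (\<forall>\<epsilon>>0. \<exists>M. \<forall>m\<ge>M. \<forall>n\<ge>M. av (X m - X n) < \<epsilon>)"

definition algebraic_over_Q :: "'k::field \<Rightarrow> bool" where
  "algebraic_over_Q z \<longleftrightarrow> (\<exists>q::int poly. q \<noteq> 0 \<and> poly (map_poly of_int q) z = 0)"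

text \<open>(k, av) is (isometrically isomorphic to) C_p: av is a non-archimedean absolute
  value extending the normalised p-adic absolute value on Q, k is complete and
  algebraically closed, and the algebraic numbers (= algebraic closure of Q_p inside k)
  are dense.\<close>
definition is_Cp :: "nat \<Rightarrow> ('k::field \<Rightarrow> real) \<Rightarrow> bool" where
  "is_Cp p av \<longleftrightarrow>
     (\<forall>x. 0 \<le> av x) \<and> (\<forall>x. av x = 0 \<longleftrightarrow> x = 0) \<and>
     (\<forall>x y. av (x * y) = av x * av y) \<and>
     (\<forall>x y. av (x + y) \<le> max (av x) (av y)) \<and>
     av (of_nat p) = 1 / real p \<and>
     (\<forall>n::int. coprime n (int p) \<longrightarrow> av (of_int n) = 1) \<and>
     (\<forall>X. av_cauchy av X \<longrightarrow> (\<exists>L. av_lim av X L)) \<and>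
     (\<forall>q::'k poly. degree q \<ge> 1 \<longrightarrow> (\<exists>z. poly q z = 0)) \<and>
     (\<forall>z. \<forall>\<epsilon>>0. \<exists>w. algebraic_over_Q w \<and> av (z - w) < \<epsilon>)"

definition log_series :: "('k::field \<Rightarrow> real) \<Rightarrow> 'k \<Rightarrow> 'k" where
  "log_series av x = (THE L. av_lim av
      (\<lambda>m. \<Sum>j\<in>{1..m}. (-1) ^ (j + 1) * (x - 1) ^ j / of_nat j) L)"

text \<open>Iwasawa branch of the p-adic logarithm (log_p p = 0):
  log_p z = log(z^N / p^K) / N whenever av(z^N / p^K - 1) < 1.\<close>
definition padic_log :: "nat \<Rightarrow> ('k::field \<Rightarrow> real) \<Rightarrow> 'k \<Rightarrow> 'k" where
  "padic_log p av z = (THE L. \<exists>(N::nat) (K::int). N \<ge> 1 \<and>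
      av (z ^ N / (of_nat p) powi K - 1) < 1 \<and>
      L = log_series av (z ^ N / (of_nat p) powi K) / of_nat N)"

text \<open>A Laurent polynomial in Z[Z^d] is a finitely supported a :: int^'d => int.\<close>
definition laurent_eval :: "(int^'d \<Rightarrow> int) \<Rightarrow> 'k^'d \<Rightarrow> 'k::field" where
  "laurent_eval a z = (\<Sum>\<nu>\<in>{\<nu>. a \<nu> \<noteq> 0}. of_int (a \<nu>) * (\<Prod>i\<in>UNIV. (z $ i) powi (\<nu> $ i)))"

definition padic_torus :: "('k::field \<Rightarrow> real) \<Rightarrow> ('k^'d) set" where
  "padic_torus av = {z. \<forall>i. av (z $ i) = 1}"

definition snirelman_avg :: "('k^'d \<Rightarrow> 'k::field) \<Rightarrow> nat \<Rightarrow> 'k" where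
  "snirelman_avg F N = (\<Sum>\<zeta>\<in>{\<zeta>::'k^'d. \<forall>i. (\<zeta> $ i) ^ N = 1}. F \<zeta>) / (of_nat N) ^ CARD('d)"

definition snirelman_integral_is :: "nat \<Rightarrow> ('k::field \<Rightarrow> real) \<Rightarrow> ('k^'d \<Rightarrow> 'k) \<Rightarrow> 'k \<Rightarrow> bool" where
  "snirelman_integral_is p av F L \<longleftrightarrow>
     (\<forall>\<epsilon>>0. \<exists>M. \<forall>N\<ge>M. coprime N p \<longrightarrow> av (snirelman_avg F N - L) < \<epsilon>)"

text \<open>R/Z is represented by representatives in [0,1).\<close>
definition X_f :: "(int^'d \<Rightarrow> int) \<Rightarrow> (int^'d \<Rightarrow> real) set" where
  "X_f a = {x. (\<forall>\<gamma>. 0 \<le> x \<gamma> \<and> x \<gamma> < 1) \<and>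
              (\<forall>\<gamma>. (\<Sum>\<nu>\<in>{\<nu>. a \<nu> \<noteq> 0}. real_of_int (a \<nu>) * x (\<gamma> + \<nu>)) \<in> \<int>)}"

text \<open>gamma acts by (gamma . x)(gamma') = x(gamma' - gamma).\<close>
definition Fix_sub :: "(int^'d) set \<Rightarrow> (int^'d \<Rightarrow> real) set \<Rightarrow> (int^'d \<Rightarrow> real) set" where
  "Fix_sub N X = {x\<in>X. \<forall>\<nu>\<in>N. \<forall>\<gamma>. x (\<gamma> - \<nu>) = x \<gamma>}"

definition add_subgroup :: "(int^'d) set \<Rightarrow> bool" where
  "add_subgroup N \<longleftrightarrow> 0 \<in> N \<and> (\<forall>x\<in>N. \<forall>y\<in>N. x + y \<in> N) \<and> (\<forall>x\<in>N. - x \<in> N)"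

definition cosets_of :: "(int^'d) set \<Rightarrow> (int^'d) set set" where
  "cosets_of N = (\<lambda>g. (\<lambda>y. g + y) ` N) ` UNIV"

definition sub_index :: "(int^'d) set \<Rightarrow> nat" where
  "sub_index N = card (cosets_of N)"

definition tends_to_zero :: "(nat \<Rightarrow> (int^'d) set) \<Rightarrow> bool" where
  "tends_to_zero G \<longleftrightarrow> (\<forall>n. add_subgroup (G n) \<and> finite (cosets_of (G n))) \<and>
                       (\<forall>\<gamma>. \<gamma> \<noteq> 0 \<longrightarrow> finite {n. \<gamma> \<in> G n})"

end

theory Submission
  imports Defs "Jordan_Normal_Form.Determinant" "HOL-Library.Poly_Mapping"
    "HOL-Number_Theory.Residues"
begin

text \<open>
  Restricting \<open>f\<close> to a generic one-parameter subgroup of the torus and factoring the resulting polynomial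
  shows that \<open>f\<close> has a single coefficient of maximal \<open>p\<close>-adic absolute value, so that
  \<open>f ^ (2 * (p - 1)) = p ^ k * t ^ (2 * \<mu>) * (1 + p * h)\<close> in the integral group ring. In that ring
  \<open>(1 + p * h) ^ (p ^ n) = 1 + p ^ n * e n\<close>, and the coefficients of \<open>e n\<close> converge uniformly
  \<open>p\<close>-adically. As \<open>log x\<close> is the limit of \<open>(x ^ (p ^ n) - 1) / p ^ n\<close>, and as
  \<open>det (1 + x * C) = 1 + x * tr C\<close> modulo \<open>x\<^sup>2\<close>, the logarithm of the determinant of multiplication by
  \<open>1 + p * h\<close> on the group ring of \<open>\<Gamma> / H\<close> is the index of \<open>H\<close> times the limit of the sum of the
  coefficients of \<open>e n\<close> over \<open>H\<close>. The number of fixed points is the absolute value of the determinant of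
  multiplication by \<open>f\<close>. By orthogonality of roots of unity the Snirelman averages are the same expression for
  \<open>H = N \<int>\<^sup>d\<close>, and in both cases only the coefficient at \<open>0\<close> survives in the limit.
\<close>

no_notation Matrix.vec_index (infixl \<open>$\<close> 100)

section \<open>The p-adic logarithm\<close>

locale Cp_field =
  fixes p :: nat and av :: "'k::field \<Rightarrow> real"
  assumes prime_p: "prime p" and Cp: "is_Cp p av"
begin

section \<open>Absolute values of integers and ultrametric estimates\<close>

lemma av_nonneg [simp]: "0 \<le> av x"
  and av_eq_0_iff [simp]: "av x = 0 \<longleftrightarrow> x = 0"
  and av_mult: "av (x * y) = av x * av y"
  and av_add_le: "av (x + y) \<le> max (av x) (av y)"
  and av_p: "av (of_nat p) = 1 / real p"
  and av_coprime: "coprime n (int p) \<Longrightarrow> av (of_int n) = 1"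
  and complete: "av_cauchy av X \<Longrightarrow> \<exists>L. av_lim av X L"
  and alg_closed: "Polynomial.degree q \<ge> 1 \<Longrightarrow> \<exists>z::'k. poly q z = 0"
  using Cp unfolding is_Cp_def by auto

lemma p_gt_1: "p > 1" and p_pos: "p > 0" and rp_gt_1: "real p > 1"
  using prime_p prime_gt_1_nat by (auto simp: prime_gt_0_nat)

lemma av_0 [simp]: "av 0 = 0" by simp

lemma av_1 [simp]: "av 1 = 1"
  using av_coprime[of 1] by simp

lemma av_minus [simp]: "av (- x) = av x"
  using av_coprime[of "-1"] av_mult[of "-1" x] by simp

lemma av_diff_le: "av (x - y) \<le> max (av x) (av y)"
  using av_add_le[of x "- y"] by simp

lemma av_power: "av (x ^ n) = av x ^ n"
  by (induction n) (auto simp: av_mult)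

lemma av_inverse: "av (inverse x) = inverse (av x)"
proof (cases "x = 0")
  case False
  hence "av x * av (inverse x) = 1" by (simp flip: av_mult)
  thus ?thesis by (metis inverse_unique)
qed simp

lemma av_divide: "av (x / y) = av x / av y"
  by (simp add: divide_inverse av_mult av_inverse)

lemma av_powi: "av (x powi n) = av x powi n"
  by (simp add: power_int_def av_power av_inverse)

lemma av_prod: "av (prod f A) = (\<Prod>i\<in>A. av (f i))"
  by (induction A rule: infinite_finite_induct) (auto simp: av_mult)

lemma av_sum_le:
  assumes "\<And>i. i \<in> A \<Longrightarrow> av (f i) \<le> B" "0 \<le> B"
  shows "av (sum f A) \<le> B"
  using assms
  by (induction A rule: infinite_finite_induct) (auto intro: order_trans[OF av_add_le])

lemma av_add_eq:
  assumes "av y < av x"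
  shows "av (x + y) = av x"
proof (rule antisym)
  show "av (x + y) \<le> av x" using av_add_le[of x y] assms by simp
  show "av x \<le> av (x + y)" using av_diff_le[of "x + y" y] assms by simp
qed

text \<open>Splitting off the full power of \<open>p\<close> leaves an integer prime to
  \<open>p\<close>, whose absolute value is 1.\<close>

lemma av_of_int: "n \<noteq> 0 \<Longrightarrow> av (of_int n) = 1 / real p ^ multiplicity (int p) n"
proof -
  assume n: "n \<noteq> 0"
  have pr: "prime (int p)" using prime_p by simp
  from n obtain y where y: "n = int p ^ multiplicity (int p) n * y" "\<not> int p dvd y"
    using multiplicity_decompose'[of n "int p"] pr by (metis not_prime_unit)
  have "coprime y (int p)" using y(2) pr by (meson coprime_commute prime_imp_coprime)
  hence "av (of_int (int p ^ multiplicity (int p) n * y)) = 1 / real p ^ multiplicity (int p) n"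
    by (simp add: av_mult av_power av_coprime av_p power_one_over)
  thus ?thesis using y(1) by simp
qed

lemma of_int_neq_0: "n \<noteq> 0 \<Longrightarrow> of_int n \<noteq> (0::'k)"
  using av_of_int[of n] p_pos av_eq_0_iff[of "of_int n"] by auto

lemma of_nat_neq_0: "n > 0 \<Longrightarrow> of_nat n \<noteq> (0::'k)"
  using of_int_neq_0[of "int n"] by simp

lemma av_of_int_le_1: "av (of_int n) \<le> 1"
proof (cases "n = 0")
  case False
  thus ?thesis using rp_gt_1 by (simp add: av_of_int divide_le_eq)
qed simp

lemma av_of_int_dvd: "int p ^ k dvd n \<Longrightarrow> av (of_int n) \<le> 1 / real p ^ k"
proof -
  assume "int p ^ k dvd n"
  then obtain m where "n = int p ^ k * m" by blast
  thus ?thesis using mult_left_mono[OF av_of_int_le_1[of m], of "1 / real p ^ k"]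
    by (simp add: av_mult av_power av_p power_one_over)
qed

text \<open>The power of \<open>p\<close> dividing \<open>j\<close> is at most \<open>j\<close>, so
  a denominator \<open>j\<close> in the logarithm series costs at most a factor
  \<open>j\<close>.\<close>

lemma inverse_av_of_nat_le: "j > 0 \<Longrightarrow> 1 / av (of_nat j) \<le> real j"
proof -
  assume j: "j > 0"
  have "int p ^ multiplicity (int p) (int j) \<le> int j"
    using j by (intro zdvd_imp_le multiplicity_dvd) auto
  hence "real_of_int (int p ^ multiplicity (int p) (int j)) \<le> real j" by linarith
  thus ?thesis using av_of_int[of "int j"] j by simp
qed

section \<open>Limits with respect to the absolute value\<close>

lemma av_lim_iff: "av_lim av X L \<longleftrightarrow> (\<lambda>n. av (X n - L)) \<longlonglongrightarrow> 0"
  unfolding av_lim_def LIMSEQ_iff by auto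

lemma av_lim_unique: "av_lim av X L \<Longrightarrow> av_lim av X L' \<Longrightarrow> L = L'"
proof -
  assume *: "av_lim av X L" "av_lim av X L'"
  have "(\<lambda>n. max (av (X n - L)) (av (X n - L'))) \<longlonglongrightarrow> max 0 0"
    using * by (intro tendsto_max) (auto simp: av_lim_iff)
  moreover have "av (L - L') \<le> max (av (X n - L)) (av (X n - L'))" for n
    using av_diff_le[of "X n - L'" "X n - L"] by (simp add: max.commute)
  ultimately have "av (L - L') \<le> 0" by (intro Lim_bounded2[of _ 0]) auto
  thus ?thesis by (metis antisym av_nonneg av_eq_0_iff eq_iff_diff_eq_0)
qed

lemma av_limI_bound:
  assumes "B \<longlonglongrightarrow> 0" "\<And>n. av (X n - L) \<le> B n"
  shows "av_lim av X L"
  unfolding av_lim_iff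
  by (rule tendsto_sandwich[OF _ _ tendsto_const assms(1)]) (use assms(2) in auto)

lemma av_lim_const: "av_lim av (\<lambda>n. c) c"
  by (simp add: av_lim_def)

lemma av_lim_add:
  assumes "av_lim av X L" "av_lim av Y K"
  shows "av_lim av (\<lambda>n. X n + Y n) (L + K)"
proof (rule av_limI_bound)
  show "(\<lambda>n. max (av (X n - L)) (av (Y n - K))) \<longlonglongrightarrow> 0"
    using tendsto_max[of _ 0 _ _ 0] assms unfolding av_lim_iff by fastforce
  show "av (X n + Y n - (L + K)) \<le> max (av (X n - L)) (av (Y n - K))" for n
    using av_add_le[of "X n - L" "Y n - K"] by (simp add: algebra_simps)
qed

lemma av_lim_cmult:
  assumes "av_lim av X L"
  shows "av_lim av (\<lambda>n. c * X n) (c * L)"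
proof (rule av_limI_bound)
  show "(\<lambda>n. av c * av (X n - L)) \<longlonglongrightarrow> 0"
    using tendsto_mult_right_zero assms unfolding av_lim_iff by blast
  show "av (c * X n - c * L) \<le> av c * av (X n - L)" for n
    by (simp flip: av_mult right_diff_distrib)
qed

lemma av_lim_divide: "av_lim av X L \<Longrightarrow> av_lim av (\<lambda>n. X n / c) (L / c)"
  using av_lim_cmult[of X L "1 / c"] by simp

lemma av_lim_sum:
  "(\<And>i. i \<in> A \<Longrightarrow> av_lim av (X i) (L i)) \<Longrightarrow> av_lim av (\<lambda>n. \<Sum>i\<in>A. X i n) (sum L A)"
  by (induction A rule: infinite_finite_induct) (auto intro: av_lim_const av_lim_add)

lemma av_lim_perturb:
  assumes "av_lim av X L" "B \<longlonglongrightarrow> 0" "\<And>n. av (Y n - X n) \<le> B n"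
  shows "av_lim av Y L"
  using av_lim_add[OF assms(1) av_limI_bound[of B "\<lambda>n. Y n - X n" 0]] assms(2,3) by simp

text \<open>Closed balls are closed: otherwise a far term of \<open>X\<close> would be strictly
  nearer to \<open>L\<close> than \<open>c\<close> is, and the ultrametric inequality would put
  \<open>L\<close> within \<open>B\<close> of \<open>c\<close> after all.\<close>

lemma av_lim_bounded:
  assumes "av_lim av X L" "\<And>n. n \<ge> k \<Longrightarrow> av (X n - c) \<le> B"
  shows "av (L - c) \<le> B"
proof (rule ccontr)
  assume "\<not> ?thesis"
  hence B: "av (L - c) > B" by simp
  have "B \<ge> 0" using assms(2)[of k] av_nonneg order_trans by blast
  then obtain M where M: "\<And>n. n \<ge> M \<Longrightarrow> av (X n - L) < av (L - c)"
    using assms(1) B unfolding av_lim_def by (metis le_less_trans)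
  define n where "n = max M k"
  have "av (L - c) \<le> max (av (X n - c)) (av (X n - L))"
    using av_diff_le[of "X n - c" "X n - L"] by simp
  thus False using M[of n] assms(2)[of n] B by (auto simp: n_def)
qed

lemma inverse_p_power_tendsto_0: "(\<lambda>n. 1 / real p ^ n) \<longlonglongrightarrow> 0"
  using LIMSEQ_inverse_realpow_zero[OF rp_gt_1] by (simp add: inverse_eq_divide)

text \<open>In an ultrametric the distance of two terms is at most the largest step between them, so
  null steps suffice.\<close>

lemma av_cauchyI:
  assumes B: "B \<longlonglongrightarrow> 0" and le: "\<And>n. av (X (Suc n) - X n) \<le> B n"
  shows "av_cauchy av X"
  unfolding av_cauchy_def
proof (intro allI impI)
  fix e :: real assume e: "e > 0"
  then obtain M where M: "\<And>n. n \<ge> M \<Longrightarrow> B n < e"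
    using order_tendstoD(2)[OF B] by (auto simp: eventually_sequentially)
  have *: "av (X n - X M) < e" if "n \<ge> M" for n
    using that
  proof (induction n rule: dec_induct)
    case (step n)
    have "av (X (Suc n) - X n + (X n - X M)) < e"
      using step le[of n] M[of n] by (intro le_less_trans[OF av_add_le]) auto
    thus ?case by simp
  qed (use e in simp)
  show "\<exists>M. \<forall>m\<ge>M. \<forall>n\<ge>M. av (X m - X n) < e"
  proof (intro exI allI impI)
    fix m n assume "m \<ge> M" "n \<ge> M"
    thus "av (X m - X n) < e"
      using *[of m] *[of n] av_diff_le[of "X m - X M" "X n - X M"] by simp
  qed
qed

section \<open>The logarithm series as a limit of difference quotients\<close>

text \<open>Induction by Pascal's rule: neighbouring binomials of row \<open>q - 1\<close> add up to
  \<open>q choose Suc j\<close>, which is \<open>q / Suc j\<close> times an integer and therefore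
  small. Each step thus flips the sign up to a small error.\<close>

lemma av_binomial_alternating:
  assumes "q = p ^ n" "j < q"
  shows "av (of_nat ((q - 1) choose j) - (-1) ^ j) \<le> real j / real p ^ n"
  using assms(2)
proof (induction j)
  case (Suc j)
  have "Suc j * (q choose Suc j) = q * ((q - 1) choose j)"
    using Suc.prems Suc_times_binomial_eq[of "q - 1" j] by (simp add: mult.commute)
  hence "av (of_nat (Suc j * (q choose Suc j))) = av (of_nat (q * ((q - 1) choose j)))" by simp
  hence "av (of_nat (Suc j)) * av (of_nat (q choose Suc j)) 
      = 1 / real p ^ n * av (of_nat ((q - 1) choose j))"
    by (simp only: of_nat_mult av_mult) (simp add: assms(1) av_power av_p power_one_over)
  also have "\<dots> \<le> 1 / real p ^ n * 1"
    using av_of_int_le_1[of "int ((q - 1) choose j)"] by (intro mult_left_mono) auto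
  finally have "av (of_nat (q choose Suc j)) * av (of_nat (Suc j)) \<le> 1 / real p ^ n"
    by (simp only: mult.commute mult_1)
  moreover have "av (of_nat (Suc j)) > 0"
    using of_nat_neq_0[of "Suc j"] by (simp add: order_less_le del: of_nat_Suc)
  ultimately have "av (of_nat (q choose Suc j)) \<le> (1 / real p ^ n) / av (of_nat (Suc j))"
    by (simp only: pos_le_divide_eq)
  hence "av (of_nat (q choose Suc j)) \<le> (1 / real p ^ n) * (1 / av (of_nat (Suc j)))" by simp
  also have "\<dots> \<le> (1 / real p ^ n) * real (Suc j)"
    by (intro mult_left_mono inverse_av_of_nat_le) auto
  finally have 1: "av (of_nat (q choose Suc j)) \<le> real (Suc j) / real p ^ n" by simp
  have "((q - 1) choose Suc j) + ((q - 1) choose j) = q choose Suc j"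
    using Suc.prems by (cases q) auto
  hence "of_nat ((q - 1) choose Suc j) = (of_nat (q choose Suc j) - of_nat ((q - 1) choose j) :: 'k)"
    by (metis add_diff_cancel_right' of_nat_add)
  hence "of_nat ((q - 1) choose Suc j) - (-1) ^ Suc j
        = (of_nat (q choose Suc j) - (of_nat ((q - 1) choose j) - (-1) ^ j) :: 'k)" by simp
  moreover have "av (of_nat ((q - 1) choose j) - (-1) ^ j) \<le> real (Suc j) / real p ^ n"
    using Suc by (intro order_trans[OF Suc.IH]) (auto intro!: divide_right_mono)
  ultimately show ?case
    using 1 by (simp only:) (rule order_trans[OF av_diff_le], rule max.boundedI)
qed simp

text \<open>Used with \<open>r = av (x - 1)\<close>: one factor \<open>j\<close> absorbs the
  denominator of a term of the logarithm series, the other the error of a binomial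
  coefficient.\<close>

lemma square_times_power_bounded:
  fixes r :: real
  assumes "0 \<le> r" "r < 1"
  shows "\<exists>K. \<forall>j. real j ^ 2 * r ^ j \<le> K"
proof -
  \<comment> \<open>The square root lets \<open>j ^ 2 * r ^ j\<close> be bounded by the square of
    the null sequence \<open>j * s ^ j\<close>; the maximum with 1/4 keeps \<open>s\<close> positive
    when \<open>r = 0\<close>.\<close>
  define s where "s = sqrt (max r (1/4))"
  have s: "0 < s" "s < 1" "r \<le> s ^ 2"
    using assms real_sqrt_lt_1_iff[of "max r (1/4)"] by (auto simp: s_def)
  have "(\<lambda>n. real n / (1 / s) ^ n) \<longlonglongrightarrow> 0"
    using lim_n_over_pown[of "1 / s"] s by simp
  hence "Bseq (\<lambda>n. real n * s ^ n)"
    by (intro convergent_imp_Bseq) (auto simp: power_one_over convergent_def)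
  then obtain K where K: "\<And>n. real n * s ^ n \<le> K"
    unfolding Bseq_def by (metis abs_ge_self order_trans real_norm_def)
  show ?thesis
  proof (intro exI allI)
    fix j
    have "real j ^ 2 * r ^ j \<le> real j ^ 2 * (s ^ 2) ^ j"
      using s assms by (intro mult_left_mono power_mono) auto
    also have "\<dots> = (real j * s ^ j) ^ 2" by (simp add: power_mult_distrib flip: power_mult, simp add: mult.commute)
    also have "\<dots> \<le> K ^ 2" using K[of j] s by (intro power_mono) auto
    finally show "real j ^ 2 * r ^ j \<le> K ^ 2" .
  qed
qed

text \<open>Writing \<open>x = 1 + u\<close> and \<open>q = p ^ n\<close>, the coefficient of \<open>u ^ j / j\<close> in \<open>(x ^ q - 1) / q\<close> is
  \<open>binomial (q - 1) (j - 1)\<close>, which tends \<open>p\<close>-adically to \<open>(-1) ^ (j - 1)\<close>.\<close>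
lemma log_series_limit:
  assumes "av (x - 1) < 1"
  shows "av_lim av (\<lambda>n. (x ^ (p ^ n) - 1) / of_nat (p ^ n)) (log_series av x)"
proof -
  define u r where "u = x - 1" and "r = av u"
  have r: "0 \<le> r" "r < 1" using assms by (auto simp: r_def u_def)
  define t :: "nat \<Rightarrow> 'k" where "t = (\<lambda>j. u ^ j / of_nat j)"
  have t_le: "av (t j) \<le> real j * r ^ j" if "j > 0" for j
  proof -
    have "av (t j) = (1 / av (of_nat j)) * r ^ j" by (simp add: t_def av_divide av_power r_def)
    also have "\<dots> \<le> real j * r ^ j"
      using inverse_av_of_nat_le[OF that] r by (intro mult_right_mono) auto
    finally show ?thesis .
  qed
  obtain K where K: "\<And>j. real j ^ 2 * r ^ j \<le> K" using square_times_power_bounded[OF r] by auto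
  have K0: "K \<ge> 0" using K[of 0] by simp
  define s :: "nat \<Rightarrow> 'k" where "s = (\<lambda>m. \<Sum>j\<in>{1..m}. (-1) ^ (j + 1) * (x - 1) ^ j / of_nat j)"
  have "av_cauchy av s"
  proof (rule av_cauchyI)
    show "(\<lambda>n. K * inverse (real (Suc n))) \<longlonglongrightarrow> 0"
      using tendsto_mult_right_zero[OF LIMSEQ_inverse_real_of_nat, of K] .
    fix n
    have "av (s (Suc n) - s n) = av (t (Suc n))"
      by (simp add: s_def t_def u_def av_mult av_divide av_power)
    also have "\<dots> \<le> real (Suc n) * r ^ Suc n" by (rule t_le) simp
    \<comment> \<open>Inserting a second factor \<open>Suc n\<close> trades the geometric decay for
      the bound \<open>K\<close> and leaves a null sequence.\<close>
    also have "\<dots> = (real (Suc n)) ^ 2 * r ^ Suc n * inverse (real (Suc n))"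
      by (simp add: power2_eq_square)
    also have "\<dots> \<le> K * inverse (real (Suc n))" by (intro mult_right_mono K) auto
    finally show "av (s (Suc n) - s n) \<le> K * inverse (real (Suc n))" .
  qed
  then obtain L where L: "av_lim av s L" using complete by blast
  have "log_series av x = L"
    unfolding log_series_def using L av_lim_unique unfolding s_def by (intro the_equality) auto
  with L have sL: "av_lim av s (log_series av x)" by simp
  \<comment> \<open>Partial sums of length \<open>p ^ n\<close> suffice, and they have as many terms
    as the binomial expansion of \<open>x ^ (p ^ n) - 1\<close>.\<close>
  have "av_lim av (\<lambda>n. s (p ^ n)) (log_series av x)"
    using LIMSEQ_subseq_LIMSEQ[of "\<lambda>n. av (s n - log_series av x)" 0 "\<lambda>n. p ^ n"] sL p_gt_1
    by (auto simp: av_lim_iff strict_mono_def o_def)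
  thus "av_lim av (\<lambda>n. (x ^ (p ^ n) - 1) / of_nat (p ^ n)) (log_series av x)"
  proof (rule av_lim_perturb)
    show "(\<lambda>n. K * (1 / real p ^ n)) \<longlonglongrightarrow> 0"
      by (intro tendsto_mult_right_zero inverse_p_power_tendsto_0)
    fix n
    define q where "q = p ^ n"
    have q: "q > 0" using p_pos by (simp add: q_def)
    have qk: "of_nat q \<noteq> (0::'k)" using q of_nat_neq_0 by blast
    have "x ^ q = (u + 1) ^ q" by (simp add: u_def)
    also have "\<dots> = (\<Sum>j\<le>q. of_nat (q choose j) * u ^ j)" by (simp add: binomial_ring)
    also have "{..q} = insert 0 {1..q}" by auto
    finally have "(x ^ q - 1) / of_nat q = (\<Sum>j\<in>{1..q}. of_nat (q choose j) * u ^ j / of_nat q)"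
      by (simp add: sum_divide_distrib)
    also have "\<dots> = (\<Sum>j\<in>{1..q}. of_nat ((q - 1) choose (j - 1)) * t j)"
    proof (rule sum.cong[OF refl])
      fix j assume j: "j \<in> {1..q}"
      have "j * (q choose j) = q * ((q - 1) choose (j - 1))"
        using times_binomial_minus1_eq[of j q] j by simp
      hence "of_nat j * of_nat (q choose j) = (of_nat q * of_nat ((q - 1) choose (j - 1)) :: 'k)"
        by (metis of_nat_mult)
      thus "of_nat (q choose j) * u ^ j / of_nat q = of_nat ((q - 1) choose (j - 1)) * t j"
        using qk of_nat_neq_0[of j] j by (simp add: t_def field_simps)
    qed
    finally have "(x ^ q - 1) / of_nat q - s q
        = (\<Sum>j\<in>{1..q}. (of_nat ((q - 1) choose (j - 1)) - (-1) ^ (j - 1)) * t j)"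
      unfolding s_def
      by (simp only: sum_subtractf[symmetric])
        (rule sum.cong, auto simp: t_def u_def algebra_simps minus_one_power_iff)
    moreover have "av ((of_nat ((q - 1) choose (j - 1)) - (-1) ^ (j - 1)) * t j) \<le> K * (1 / real p ^ n)"
      if j: "j \<in> {1..q}" for j
    proof -
      have "av (of_nat ((q - 1) choose (j - 1)) - (-1) ^ (j - 1)) \<le> real (j - 1) / real p ^ n"
        using j by (intro av_binomial_alternating q_def) auto
      also have "\<dots> \<le> real j / real p ^ n" by (intro divide_right_mono) auto
      finally have "av ((of_nat ((q - 1) choose (j - 1)) - (-1) ^ (j - 1)) * t j)
          \<le> (real j / real p ^ n) * (real j * r ^ j)"
        unfolding av_mult using t_le[of j] j by (intro mult_mono) auto
      also have "\<dots> = real j ^ 2 * r ^ j * (1 / real p ^ n)" by (simp add: power2_eq_square)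
      also have "\<dots> \<le> K * (1 / real p ^ n)" by (intro mult_right_mono K) auto
      finally show ?thesis .
    qed
    ultimately show "av ((x ^ (p ^ n) - 1) / of_nat (p ^ n) - s (p ^ n)) \<le> K * (1 / real p ^ n)"
      using K0 unfolding q_def[symmetric] by (simp only:) (intro av_sum_le, auto)
  qed
qed

lemma log_series_1 [simp]: "log_series av 1 = 0"
  using log_series_limit[of 1] av_lim_unique[OF _ av_lim_const[of 0]] by simp

section \<open>The functional equation and the Iwasawa branch\<close>

lemma av_eq_1_if_near_1:
  assumes "av (x - 1) < 1" shows "av x = 1"
  using av_add_eq[of "x - 1" 1] assms by simp

lemma near_1_mult:
  assumes "av (x - 1) < 1" "av (y - 1) < 1" shows "av (x * y - 1) < 1"
proof -
  have "x * y - 1 = x * (y - 1) + (x - 1)" by (simp add: algebra_simps)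
  thus ?thesis using assms av_eq_1_if_near_1[OF assms(1)]
    by (simp only:) (intro le_less_trans[OF av_add_le], simp add: av_mult)
qed

lemma near_1_power:
  assumes "av (x - 1) < 1" shows "av (x ^ n - 1) < 1"
  by (induction n) (auto intro: near_1_mult assms)

text \<open>Apply \<open>x * y - 1 = (x - 1) + (y - 1) + (x - 1) * (y - 1)\<close> to
  \<open>p ^ n\<close>-th powers: the difference quotients are additive up to
  \<open>?X n * ?Y n * ?q n\<close>, a product of two bounded factors and a null one.\<close>

lemma log_series_mult:
  assumes "av (x - 1) < 1" "av (y - 1) < 1"
  shows "log_series av (x * y) = log_series av x + log_series av y"
proof (rule av_lim_unique[OF log_series_limit[OF near_1_mult[OF assms]]])
  let ?q = "\<lambda>n. of_nat (p ^ n) :: 'k"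
  let ?X = "\<lambda>n. (x ^ (p ^ n) - 1) / ?q n" and ?Y = "\<lambda>n. (y ^ (p ^ n) - 1) / ?q n"
  have X: "av_lim av ?X (log_series av x)" and Y: "av_lim av ?Y (log_series av y)"
    using log_series_limit assms by blast+
  show "av_lim av (\<lambda>n. ((x * y) ^ (p ^ n) - 1) / ?q n) (log_series av x + log_series av y)"
  proof (rule av_lim_perturb[OF av_lim_add[OF X Y]])
    \<comment> \<open>\<open>?X n\<close> and \<open>?Y n\<close> are bounded through their limits,
      so that \<open>?B\<close> is built from sequences whose limits are known.\<close>
    let ?B = "\<lambda>n. max (av (?X n - log_series av x)) (av (log_series av x))
                 * (max (av (?Y n - log_series av y)) (av (log_series av y)) * (1 / real p ^ n))"
    show "?B \<longlonglongrightarrow> 0"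
      using tendsto_mult[OF tendsto_max[OF X[unfolded av_lim_iff] tendsto_const]
          tendsto_mult[OF tendsto_max[OF Y[unfolded av_lim_iff] tendsto_const] inverse_p_power_tendsto_0]]
      by simp
    fix n
    have q0: "?q n \<noteq> 0" using of_nat_neq_0 p_pos by simp
    have "((x * y) ^ (p ^ n) - 1) / ?q n - (?X n + ?Y n) = ?X n * (?Y n * ?q n)"
      using q0 by (simp add: power_mult_distrib field_simps del: of_nat_power)
    moreover have "av (?X n) \<le> max (av (?X n - log_series av x)) (av (log_series av x))"
      using av_add_le[of "?X n - log_series av x" "log_series av x"] by simp
    moreover have "av (?Y n) \<le> max (av (?Y n - log_series av y)) (av (log_series av y))"
      using av_add_le[of "?Y n - log_series av y" "log_series av y"] by simp
    moreover have "av (?q n) = 1 / real p ^ n" by (simp add: av_power av_p power_one_over)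
    ultimately show "av (((x * y) ^ (p ^ n) - 1) / ?q n - (?X n + ?Y n)) \<le> ?B n"
      by (simp only: av_mult) (intro mult_mono mult_nonneg_nonneg order_refl, auto simp: le_max_iff_disj)
  qed
qed

lemma log_series_power:
  assumes "av (x - 1) < 1"
  shows "log_series av (x ^ n) = of_nat n * log_series av x"
  by (induction n) (auto simp: log_series_mult near_1_power assms algebra_simps)

text \<open>The definite description does not depend on the choice: for two admissible pairs the
  absolute values force \<open>K * int N' = K' * int N\<close>, so the two quotients have a common
  power, and \<open>log_series\<close> turns powers into multiples.\<close>

lemma padic_log_eqI:
  fixes N :: nat and K :: int
  assumes N: "N \<ge> 1" and near: "av (z ^ N / (of_nat p) powi K - 1) < 1"
  shows "padic_log p av z = log_series av (z ^ N / (of_nat p) powi K) / of_nat N"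
  unfolding padic_log_def
proof (rule the_equality)
  show "\<exists>(N'::nat) (K'::int). N' \<ge> 1 \<and> av (z ^ N' / (of_nat p) powi K' - 1) < 1 \<and>
      log_series av (z ^ N / (of_nat p) powi K) / of_nat N
      = log_series av (z ^ N' / (of_nat p) powi K') / of_nat N'"
    using assms by blast
next
  fix L assume "\<exists>(N'::nat) (K'::int). N' \<ge> 1 \<and> av (z ^ N' / (of_nat p) powi K' - 1) < 1 \<and>
      L = log_series av (z ^ N' / (of_nat p) powi K') / of_nat N'"
  then obtain N' :: nat and K' :: int where N': "N' \<ge> 1" "av (z ^ N' / (of_nat p) powi K' - 1) < 1"
    and L: "L = log_series av (z ^ N' / (of_nat p) powi K') / of_nat N'" by blast
  let ?x = "z ^ N / (of_nat p) powi K" and ?x' = "z ^ N' / (of_nat p) powi K'"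
  have p0: "of_nat p \<noteq> (0::'k)" using of_nat_neq_0 p_pos by blast
  have "av ?x = 1" "av ?x' = 1" using av_eq_1_if_near_1 near N'(2) by auto
  hence "av z ^ N = (1 / real p) powi K" "av z ^ N' = (1 / real p) powi K'"
    using p_pos by (auto simp: av_divide av_powi av_power av_p divide_eq_1_iff)
  \<comment> \<open>Raised to the powers \<open>N'\<close> and \<open>N\<close>, the two equations
    have the same left-hand side; powers of \<open>1 / p\<close> determine their exponents.\<close>
  hence "(1 / real p) powi (K * int N') = (1 / real p) powi (K' * int N)"
    by (metis power_int_mult power_int_of_nat power_mult mult.commute)
  hence "real p powi (K * int N') = real p powi (K' * int N)"
    by (simp add: power_int_divide_distrib p_pos)
  hence K: "K * int N' = K' * int N"
    using power_int_strict_increasing[of _ _ "real p"] rp_gt_1 by (metis less_irrefl linorder_neqE)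
  have "?x ^ N' = z ^ (N * N') / of_nat p powi (K * int N')"
    by (simp add: power_divide power_mult power_int_mult)
  also have "\<dots> = ?x' ^ N" unfolding K
    by (simp add: power_divide power_int_mult mult.commute[of N] power_mult)
  finally have "of_nat N' * log_series av ?x = of_nat N * log_series av ?x'"
    using log_series_power near N'(2) by metis
  thus "L = log_series av ?x / of_nat N"
    using of_nat_neq_0[of N] of_nat_neq_0[of N'] N N'(1) by (simp add: L field_simps)
qed

end

section \<open>Determinants and torus endomorphisms\<close>

lemma prod_one_plus_mult:
  fixes x :: "'a::comm_ring_1"
  assumes "finite A"
  shows "x\<^sup>2 dvd (\<Prod>i\<in>A. 1 + x * c i) - (1 + x * (\<Sum>i\<in>A. c i))"
  using assms
proof (induction A rule: finite_induct)
  case (insert i A)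
  then obtain r where r: "(\<Prod>i\<in>A. 1 + x * c i) - (1 + x * (\<Sum>i\<in>A. c i)) = x\<^sup>2 * r"
    by (auto elim: dvdE)
  hence "(\<Prod>i\<in>A. 1 + x * c i) = 1 + x * (\<Sum>i\<in>A. c i) + x\<^sup>2 * r" by (simp add: algebra_simps)
  hence "(\<Prod>i\<in>insert i A. 1 + x * c i) - (1 + x * (\<Sum>i\<in>insert i A. c i))
      = x\<^sup>2 * (c i * (\<Sum>i\<in>A. c i) + r + x * c i * r)"
    using insert by (simp add: algebra_simps power2_eq_square)
  thus ?case by simp
qed simp

text \<open>In the Leibniz formula only the identity contributes modulo \<open>x\<^sup>2\<close>
  beyond 0: any other permutation moves at least two indices, and each of them gives an off-diagonal
  factor divisible by \<open>x\<close>.\<close>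

lemma det_one_plus_mult:
  fixes x :: "'a::comm_ring_1"
  shows "x\<^sup>2 dvd Determinant.det (Matrix.mat m m (\<lambda>(i,j). of_bool (i = j) + x * c i j))
                  - (1 + x * (\<Sum>i<m. c i i))"
proof -
  let ?A = "Matrix.mat m m (\<lambda>(i,j). of_bool (i = j) + x * c i j)"
  let ?t = "\<lambda>\<pi>. signof \<pi> * (\<Prod>i = 0..<m. ?A $$ (i, \<pi> i))"
  let ?P = "{\<pi>. \<pi> permutes {0..<m}}"
  have fin: "finite ?P" by (intro finite_permutations) auto
  have "Determinant.det ?A = (\<Sum>\<pi>\<in>?P. ?t \<pi>)"
    by (rule det_def') simp
  also have "\<dots> = ?t id + (\<Sum>\<pi>\<in>?P - {id}. ?t \<pi>)"
    using fin by (subst sum.remove[of _ id]) (auto simp: permutes_id)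
  also have "?t id = (\<Prod>i\<in>{..<m}. 1 + x * c i i)"
    by (simp add: atLeast0LessThan)
  finally have eq: "Determinant.det ?A - (1 + x * (\<Sum>i<m. c i i))
     = ((\<Prod>i\<in>{..<m}. 1 + x * c i i) - (1 + x * (\<Sum>i<m. c i i))) + (\<Sum>\<pi>\<in>?P - {id}. ?t \<pi>)"
    by (simp only: diff_add_eq)
  have "x\<^sup>2 dvd ?t \<pi>" if "\<pi> \<in> ?P - {id}" for \<pi>
  proof -
    from that have \<pi>: "\<pi> permutes {0..<m}" "\<pi> \<noteq> id" by auto
    then obtain i where i: "\<pi> i \<noteq> i" by fastforce
    have im: "i < m" using permutes_not_in[OF \<pi>(1), of i] i by auto
    have jm: "\<pi> i < m" using permutes_in_image[OF \<pi>(1), of i] im by auto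
    have j: "\<pi> (\<pi> i) \<noteq> \<pi> i" using i permutes_inj[OF \<pi>(1)] by (auto dest: injD)
    have *: "\<pi> k < m" if "k < m" for k using permutes_in_image[OF \<pi>(1), of k] that by auto
    \<comment> \<open>Along with \<open>i\<close> its image \<open>\<pi> i\<close> is moved; the
      factors at these two indices are taken out of the product.\<close>
    have "(\<Prod>k = 0..<m. ?A $$ (k, \<pi> k))
        = ?A $$ (i, \<pi> i) * (?A $$ (\<pi> i, \<pi> (\<pi> i)) * (\<Prod>k\<in>{0..<m} - {i} - {\<pi> i}. ?A $$ (k, \<pi> k)))"
      using im jm i by (subst prod.remove[of _ i], simp, simp, subst prod.remove[of _ "\<pi> i"]) auto
    also have "?A $$ (i, \<pi> i) = x * c i (\<pi> i)" using im jm i by auto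
    also have "?A $$ (\<pi> i, \<pi> (\<pi> i)) = x * c (\<pi> i) (\<pi> (\<pi> i))" using jm j *[OF jm] by auto
    finally have *: "(\<Prod>k = 0..<m. ?A $$ (k, \<pi> k)) = x\<^sup>2 * (c i (\<pi> i) * c (\<pi> i) (\<pi> (\<pi> i)) *
        (\<Prod>k\<in>{0..<m} - {i} - {\<pi> i}. ?A $$ (k, \<pi> k)))"
      by (simp only: power2_eq_square ac_simps)
    show ?thesis unfolding * by (rule dvd_mult, rule dvd_triv_left)
  qed
  thus ?thesis unfolding eq by (intro dvd_add prod_one_plus_mult dvd_sum) auto
qed

section \<open>Kernels of integral matrices acting on real tori\<close>

text \<open>The kernel of \<open>A\<close> on \<open>(\<real>/\<int>)^m\<close>. Fixing the value 0
  from \<open>m\<close> on gives each point exactly one representing function, so that cardinalities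
  are correct.\<close>

definition torus_kernel :: "nat \<Rightarrow> int mat \<Rightarrow> (nat \<Rightarrow> real) set" where
  "torus_kernel m A = {x. (\<forall>j<m. 0 \<le> x j \<and> x j < 1) \<and> (\<forall>j\<ge>m. x j = 0) \<and>
     (\<forall>i<m. (\<Sum>j<m. real_of_int (A $$ (i,j)) * x j) \<in> \<int>)}"

text \<open>For \<open>a > 0\<close> the values \<open>a * t + s\<close> fill a half-open interval
  of length \<open>a\<close>, which contains exactly \<open>a\<close> integers. Changing the signs
  of \<open>a\<close> and \<open>s\<close> reduces the negative case to this one.\<close>

lemma card_affine_fibre:
  fixes a :: int and s :: real
  assumes "a \<noteq> 0"
  shows "finite {t::real. 0 \<le> t \<and> t < 1 \<and> real_of_int a * t + s \<in> \<int>} \<and>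
         int (card {t::real. 0 \<le> t \<and> t < 1 \<and> real_of_int a * t + s \<in> \<int>}) = \<bar>a\<bar>"
proof -
  have pos: "finite {t::real. 0 \<le> t \<and> t < 1 \<and> real_of_int a * t + s \<in> \<int>} \<and>
         int (card {t::real. 0 \<le> t \<and> t < 1 \<and> real_of_int a * t + s \<in> \<int>}) = a"
    if a: "a > 0" for a s
  proof -
    let ?T = "{t::real. 0 \<le> t \<and> t < 1 \<and> real_of_int a * t + s \<in> \<int>}"
    let ?f = "\<lambda>k::int. (real_of_int k - s) / real_of_int a"
    have "bij_betw ?f {\<lceil>s\<rceil>..<\<lceil>s\<rceil> + a} ?T"
    proof (rule bij_betwI[where g = "\<lambda>t. \<lfloor>real_of_int a * t + s\<rfloor>"], goal_cases)
      case 1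
      show ?case
      proof
        fix k assume k: "k \<in> {\<lceil>s\<rceil>..<\<lceil>s\<rceil> + a}"
        hence "s \<le> real_of_int k" "real_of_int k < s + real_of_int a" by (auto simp: ceiling_le_iff) linarith
        thus "?f k \<in> ?T" using a by (auto simp: field_simps)
      qed
    next
      case 2
      show ?case
      proof
        fix t assume t: "t \<in> ?T"
        then obtain k where k: "real_of_int a * t + s = real_of_int k" by (auto elim: Ints_cases)
        have "0 \<le> real_of_int a * t" "real_of_int a * t < real_of_int a" using t a by auto
        hence "s \<le> real_of_int k" "real_of_int k < s + real_of_int a" using k by linarith+
        hence "\<lceil>s\<rceil> \<le> k" "k < \<lceil>s\<rceil> + a" by (auto simp: ceiling_le_iff) linarith
        thus "\<lfloor>real_of_int a * t + s\<rfloor> \<in> {\<lceil>s\<rceil>..<\<lceil>s\<rceil> + a}" using k by simp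
      qed
    next
      case (3 k) thus ?case using a by simp
    next
      case (4 t)
      then obtain k where k: "real_of_int a * t + s = real_of_int k" by (auto elim: Ints_cases)
      thus ?case using a by (simp add: field_simps)
    qed
    hence "finite ?T" "card ?T = card {\<lceil>s\<rceil>..<\<lceil>s\<rceil> + a}"
      by (auto simp: bij_betw_finite[symmetric] bij_betw_same_card[symmetric])
    thus ?thesis using a by simp
  qed
  show ?thesis
  proof (cases "a > 0")
    case False
    have "real_of_int a * t + s \<in> \<int> \<longleftrightarrow> real_of_int (- a) * t + (- s) \<in> \<int>" for t
      using minus_in_Ints_iff[of "real_of_int a * t + s"] by (simp add: algebra_simps)
    thus ?thesis using pos[of "- a" "- s"] False assms by (simp only: abs_if) auto
  qed (use pos in auto)
qed

text \<open>Row \<open>l\<close> is kept because \<open>k \<noteq> l\<close>, so subtracting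
  \<open>c\<close> times it recovers row \<open>k\<close> and the operation is reversible over the
  integers.\<close>

lemma torus_kernel_addrow:
  assumes A: "A \<in> carrier_mat m m" and k: "k < m" and l: "l < m" and kl: "k \<noteq> l"
  shows "torus_kernel m (addrow c k l A) = torus_kernel m A"
proof -
  let ?r = "\<lambda>A x i. \<Sum>j<m. real_of_int (A $$ (i,j)) * x j"
  have "(\<forall>i<m. ?r (addrow c k l A) x i \<in> \<int>) \<longleftrightarrow> (\<forall>i<m. ?r A x i \<in> \<int>)" for x
  proof -
    have *: "?r (addrow c k l A) x i = (if i = k then real_of_int c * ?r A x l + ?r A x k else ?r A x i)"
      if "i < m" for i
      using A that by (auto simp: algebra_simps sum.distrib sum_distrib_left intro!: sum.cong)
    define R R' where "R = ?r A x" and "R' = ?r (addrow c k l A) x"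
    have R': "R' i = (if i = k then of_int c * R l + R k else R i)" if "i < m" for i
      using *[OF that] unfolding R_def R'_def .
    have cl: "of_int c * R l \<in> \<int>" if "R l \<in> \<int>"
      using that by (intro Ints_mult) auto
    have "(\<forall>i<m. R' i \<in> \<int>) \<longleftrightarrow> (\<forall>i<m. R i \<in> \<int>)"
    proof (intro iffI allI impI)
      fix i assume R'_int: "\<forall>i<m. R' i \<in> \<int>" and i: "i < m"
      hence "R l \<in> \<int>" using R'[OF l] l kl by auto
      moreover have "of_int c * R l + R k \<in> \<int>" using R'[OF k] k R'_int by auto
      ultimately have "R k \<in> \<int>" using Ints_diff[OF _ cl] by fastforce
      thus "R i \<in> \<int>" using R'[OF i] R'_int i by (cases "i = k") auto
    next
      fix i assume "\<forall>i<m. R i \<in> \<int>" "i < m"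
      thus "R' i \<in> \<int>" using R'[of i] cl k l by auto
    qed
    thus ?thesis unfolding R_def R'_def .
  qed
  thus ?thesis by (simp add: torus_kernel_def)
qed

lemma torus_kernel_swaprows:
  assumes A: "A \<in> carrier_mat m m" and k: "k < m" and l: "l < m"
  shows "torus_kernel m (swaprows k l A) = torus_kernel m A"
proof -
  let ?r = "\<lambda>A x i. \<Sum>j<m. real_of_int (A $$ (i,j)) * x j"
  have "(\<forall>i<m. ?r (swaprows k l A) x i \<in> \<int>) \<longleftrightarrow> (\<forall>i<m. ?r A x i \<in> \<int>)" for x
  proof -
    define \<sigma> where "\<sigma> = (\<lambda>i. if i = k then l else if i = l then k else i)"
    have "?r (swaprows k l A) x i = ?r A x (\<sigma> i)" if "i < m" for i
      using A that k l by (auto simp: \<sigma>_def intro!: sum.cong)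
    moreover have "\<sigma> (\<sigma> i) = i" "i < m \<Longrightarrow> \<sigma> i < m" for i
      using k l by (auto simp: \<sigma>_def)
    ultimately show ?thesis by metis
  qed
  thus ?thesis by (simp add: torus_kernel_def)
qed

text \<open>Euclid's algorithm on the first column by single additions and subtractions of rows,
  with the sum of absolute values as measure. It stops when at most one entry is nonzero, which a
  swap moves to the top.\<close>

lemma reduce_first_column:
  fixes A :: "int mat"
  assumes "A \<in> carrier_mat m m" "0 < m"
  shows "\<exists>B\<in>carrier_mat m m. \<bar>Determinant.det B\<bar> = \<bar>Determinant.det A\<bar>
            \<and> torus_kernel m B = torus_kernel m A \<and> (\<forall>i<m. i \<noteq> 0 \<longrightarrow> B $$ (i,0) = 0)"
  using assms(1)
proof (induction "\<Sum>i<m. nat \<bar>A $$ (i,0)\<bar>" arbitrary: A rule: less_induct)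
  case (less A)
  note A = less.prems
  show ?case
  proof (cases "\<exists>i l. i < m \<and> l < m \<and> i \<noteq> l \<and> A $$ (l,0) \<noteq> 0 \<and> \<bar>A $$ (l,0)\<bar> \<le> \<bar>A $$ (i,0)\<bar>")
    case True
    then obtain i l where il: "i < m" "l < m" "i \<noteq> l" "A $$ (l,0) \<noteq> 0" "\<bar>A $$ (l,0)\<bar> \<le> \<bar>A $$ (i,0)\<bar>"
      by blast
    \<comment> \<open>With this sign \<open>c * A $$ (l,0)\<close> is opposite to
      \<open>A $$ (i,0)\<close>, whose absolute value therefore drops by that of
      \<open>A $$ (l,0)\<close>.\<close>
    define c where "c = - sgn (A $$ (i,0)) * sgn (A $$ (l,0))"
    let ?B = "addrow c i l A"
    have B: "?B \<in> carrier_mat m m" using A by simp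
    have "(\<Sum>k<m. nat \<bar>?B $$ (k,0)\<bar>) < (\<Sum>k<m. nat \<bar>A $$ (k,0)\<bar>)"
    proof (rule sum_strict_mono_ex1)
      have *: "?B $$ (k,0) = (if k = i then c * A $$ (l,0) + A $$ (i,0) else A $$ (k,0))" if "k < m" for k
        using A that assms(2) by simp
      have **: "\<bar>c * A $$ (l,0) + A $$ (i,0)\<bar> < \<bar>A $$ (i,0)\<bar>"
        using il(4,5) by (auto simp: c_def sgn_if split: if_splits)
      show "\<forall>k\<in>{..<m}. nat \<bar>?B $$ (k,0)\<bar> \<le> nat \<bar>A $$ (k,0)\<bar>" using * ** by auto
      show "\<exists>k\<in>{..<m}. nat \<bar>?B $$ (k,0)\<bar> < nat \<bar>A $$ (k,0)\<bar>" using * ** il by (intro bexI[of _ i]) auto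
    qed simp
    from less.hyps[OF this B] show ?thesis
      using det_addrow[OF il(2,3) A] torus_kernel_addrow[OF A il(1,2,3)] by simp
  next
    case False
    show ?thesis
    proof (cases "\<forall>i<m. i \<noteq> 0 \<longrightarrow> A $$ (i,0) = 0")
      case True
      thus ?thesis using A by blast
    next
      case nz: False
      then obtain l where l: "l < m" "l \<noteq> 0" "A $$ (l,0) \<noteq> 0" by blast
      \<comment> \<open>A second nonzero entry would admit a further step, in one order of the two
        rows or the other.\<close>
      have others: "A $$ (i,0) = 0" if "i < m" "i \<noteq> l" for i
        using False l that by (metis linorder_le_cases)
      let ?B = "swaprows 0 l A"
      have "?B $$ (i,0) = 0" if "i < m" "i \<noteq> 0" for i
        using A that l others assms(2) by auto
      moreover have "\<bar>Determinant.det ?B\<bar> = \<bar>Determinant.det A\<bar>"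
        using det_swaprows[OF assms(2) l(1) _ A] l by simp
      moreover have "?B \<in> carrier_mat m m" using A by simp
      ultimately show ?thesis using torus_kernel_swaprows[OF A assms(2) l(1)] by blast
    qed
  qed
qed

text \<open>Integer row operations do not change \<^const>\<open>torus_kernel\<close> at all, so one may assume that the first
  column is supported in its first entry \<open>a\<close>; the coordinate \<open>x 0\<close> then contributes a factor \<open>\<bar>a\<bar>\<close>.\<close>
theorem card_torus_kernel:
  fixes A :: "int mat"
  assumes "A \<in> carrier_mat m m" "Determinant.det A \<noteq> 0"
  shows "finite (torus_kernel m A) \<and> int (card (torus_kernel m A)) = \<bar>Determinant.det A\<bar>"
  using assms
proof (induction m arbitrary: A)
  case 0
  have "torus_kernel 0 A = {\<lambda>_. 0}" by (auto simp: torus_kernel_def)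
  moreover have "Determinant.det A = 1" using 0 by (simp add: Determinant.det_def)
  ultimately show ?case by simp
next
  case (Suc m)
  obtain B where B: "B \<in> carrier_mat (Suc m) (Suc m)" "\<bar>Determinant.det B\<bar> = \<bar>Determinant.det A\<bar>"
      "torus_kernel (Suc m) B = torus_kernel (Suc m) A" "\<And>i. i < Suc m \<Longrightarrow> i \<noteq> 0 \<Longrightarrow> B $$ (i,0) = 0"
    using reduce_first_column[OF Suc.prems(1)] by blast
  define a where "a = B $$ (0,0)"
  define B' where "B' = mat_delete B 0 0"
  have B': "B' \<in> carrier_mat m m" unfolding B'_def using mat_delete_carrier[OF B(1)] by simp
  have B'_ij: "B' $$ (i,j) = B $$ (Suc i, Suc j)" if "i < m" "j < m" for i j
    using B(1) that by (simp add: B'_def mat_delete_def)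
  have "Determinant.det B = (\<Sum>i<Suc m. B $$ (i,0) * cofactor B i 0)"
    by (rule laplace_expansion_column[OF B(1)]) simp
  also have "\<dots> = a * cofactor B 0 0"
    by (subst sum.remove[of _ 0]) (auto simp: B(4) a_def)
  finally have detB: "Determinant.det B = a * Determinant.det B'" by (simp add: cofactor_def B'_def)
  hence a0: "a \<noteq> 0" and d0: "Determinant.det B' \<noteq> 0" using B(2) Suc.prems(2) by auto
  note IH = Suc.IH[OF B' d0]
  define s where "s = (\<lambda>x. \<Sum>j<m. real_of_int (B $$ (0, Suc j)) * x j)"
  define T where "T = (\<lambda>x. {t::real. 0 \<le> t \<and> t < 1 \<and> real_of_int a * t + s x \<in> \<int>})"
  have T: "finite (T x)" "int (card (T x)) = \<bar>a\<bar>" for x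
    using card_affine_fibre[OF a0, of "s x"] by (auto simp: T_def)
  \<comment> \<open>Below the corner \<open>a\<close> the first column is 0: the other rows see only
    the shifted vector, and row 0 is an affine condition on \<open>x 0\<close> once that vector is
    given.\<close>
  have row0: "(\<Sum>j<Suc m. real_of_int (B $$ (0,j)) * x j) = real_of_int a * x 0 + s (\<lambda>j. x (Suc j))" for x
    by (simp add: sum.lessThan_Suc_shift a_def s_def del: sum.lessThan_Suc)
  have rowS: "(\<Sum>j<Suc m. real_of_int (B $$ (Suc i,j)) * x j)
        = (\<Sum>j<m. real_of_int (B' $$ (i,j)) * x (Suc j))" if "i < m" for i x
    using that by (simp add: sum.lessThan_Suc_shift B(4) B'_ij del: sum.lessThan_Suc)
  have kernel_iff: "x \<in> torus_kernel (Suc m) B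
      \<longleftrightarrow> (\<lambda>j. x (Suc j)) \<in> torus_kernel m B' \<and> x 0 \<in> T (\<lambda>j. x (Suc j))" for x
    unfolding torus_kernel_def T_def
    by (auto simp: All_less_Suc2 row0 rowS simp del: sum.lessThan_Suc dest: spec[of _ "Suc _"] gr0_implies_Suc)
       (metis Suc_le_D Suc_le_mono)
  have "bij_betw (\<lambda>(x, t). case_nat t x) (Sigma (torus_kernel m B') T) (torus_kernel (Suc m) B)"
    by (rule bij_betwI[where g = "\<lambda>x. (\<lambda>j. x (Suc j), x 0)"])
       (auto simp: kernel_iff fun_eq_iff split: nat.splits)
  hence "finite (torus_kernel (Suc m) B)" 
    and card: "card (torus_kernel (Suc m) B) = card (Sigma (torus_kernel m B') T)"
    using IH T(1) by (auto simp: bij_betw_finite[symmetric] bij_betw_same_card[symmetric])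
  moreover have "int (card (Sigma (torus_kernel m B') T)) = \<bar>Determinant.det B\<bar>"
    using IH T by (simp add: card_SigmaI detB abs_mult)
  ultimately show ?case using B(2,3) by simp
qed

section \<open>Dominant coefficients\<close>

context Cp_field begin

text \<open>The coefficients of the product are \<open>coeff q (j - 1) - r * coeff q j\<close>. For
  \<open>av r < 1\<close> the first term wins and the dominant index moves to \<open>Suc s\<close>;
  for \<open>av r > 1\<close> the second wins and it stays at \<open>s\<close>.\<close>

lemma dominant_coeff_linear_factor:
  fixes q :: "'k poly"
  assumes dom: "\<And>j. j \<noteq> s \<Longrightarrow> av (Polynomial.coeff q j) < av (Polynomial.coeff q s)" and r: "av r \<noteq> 1"
  shows "\<exists>s'. \<forall>j. j \<noteq> s' \<longrightarrow> av (Polynomial.coeff ([:- r, 1:] * q) j) < av (Polynomial.coeff ([:- r, 1:] * q) s')"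
proof -
  \<comment> \<open>The coefficients of \<open>q\<close> times the variable, hence the value 0 at
    index 0.\<close>
  define t where "t = (\<lambda>j. case j of 0 \<Rightarrow> 0 | Suc i \<Rightarrow> Polynomial.coeff q i)"
  have coeff_eq: "Polynomial.coeff ([:- r, 1:] * q) j = t j - r * Polynomial.coeff q j" for j
    by (simp add: t_def coeff_pCons split: nat.split)
  have le: "av (Polynomial.coeff q j) \<le> av (Polynomial.coeff q s)" for j
    using dom[of j] by (cases "j = s") auto
  have t_le: "av (t j) \<le> av (Polynomial.coeff q s)" for j
    using le by (simp add: t_def split: nat.split)
  have pos: "0 < av (Polynomial.coeff q s)"
    using dom[of "Suc s"] av_nonneg[of "Polynomial.coeff q (Suc s)"] by linarith
  show ?thesis
  proof (cases "av r < 1")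
    case True
    have small: "av (r * Polynomial.coeff q j) < av (Polynomial.coeff q s)" for j
    proof -
      have "av (r * Polynomial.coeff q j) \<le> av r * av (Polynomial.coeff q s)"
        unfolding av_mult by (intro mult_left_mono le) simp
      also have "\<dots> < av (Polynomial.coeff q s)" using True pos by simp
      finally show ?thesis .
    qed
    have top: "av (Polynomial.coeff ([:- r, 1:] * q) (Suc s)) = av (Polynomial.coeff q s)"
      using av_add_eq[of "- (r * Polynomial.coeff q (Suc s))" "Polynomial.coeff q s"] small[of "Suc s"]
      unfolding coeff_eq by (simp add: t_def)
    have "av (Polynomial.coeff ([:- r, 1:] * q) j) < av (Polynomial.coeff q s)" if "j \<noteq> Suc s" for j
    proof -
      have "av (t j) < av (Polynomial.coeff q s)"
        using that dom pos by (auto simp: t_def split: nat.split)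
      thus ?thesis unfolding coeff_eq using small[of j] by (intro le_less_trans[OF av_diff_le]) simp
    qed
    thus ?thesis using top by (intro exI[of _ "Suc s"]) simp
  next
    case False
    with r have r1: "av r > 1" by simp
    have big: "av (t j) < av (r * Polynomial.coeff q s)" for j
    proof -
      have "av (t j) \<le> 1 * av (Polynomial.coeff q s)" using t_le by simp
      also have "\<dots> < av r * av (Polynomial.coeff q s)" using r1 pos by (intro mult_strict_right_mono)
      finally show ?thesis by (simp add: av_mult)
    qed
    have top: "av (Polynomial.coeff ([:- r, 1:] * q) s) = av (r * Polynomial.coeff q s)"
      using av_add_eq[of "t s" "- (r * Polynomial.coeff q s)"] big[of s]
      unfolding coeff_eq by (simp add: algebra_simps)
    have "av (Polynomial.coeff ([:- r, 1:] * q) j) < av (r * Polynomial.coeff q s)" if "j \<noteq> s" for j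
    proof -
      have "av (r * Polynomial.coeff q j) < av (r * Polynomial.coeff q s)"
        using dom[OF that] r1 by (simp add: av_mult)
      thus ?thesis unfolding coeff_eq using big[of j] by (intro le_less_trans[OF av_diff_le]) simp
    qed
    thus ?thesis using top by (intro exI[of _ s]) simp
  qed
qed

text \<open>Split off a root, which exists because the field is algebraically closed. Its absolute
  value is not 1, so the linear factor preserves dominance, and the roots of the cofactor are again
  roots of \<open>q\<close>.\<close>

lemma dominant_coeff_exists:
  fixes q :: "'k poly"
  assumes "q \<noteq> 0" "\<And>z. poly q z = 0 \<Longrightarrow> av z \<noteq> 1"
  shows "\<exists>s. \<forall>j. j \<noteq> s \<longrightarrow> av (Polynomial.coeff q j) < av (Polynomial.coeff q s)"
  using assms
proof (induction "Polynomial.degree q" arbitrary: q)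
  case 0
  then obtain c where c: "q = [:c:]" by (metis degree_eq_zeroE)
  with 0 have "0 < av c" using av_nonneg[of c] by (auto simp: order_less_le)
  thus ?case by (intro exI[of _ 0]) (auto simp: c coeff_pCons split: nat.split)
next
  case (Suc n)
  then obtain z where z: "poly q z = 0" using alg_closed[of q] by auto
  then obtain q' where q': "q = [:- z, 1:] * q'" by (metis poly_eq_0_iff_dvd dvdE)
  have q'0: "q' \<noteq> 0" using Suc.prems(1) q' by auto
  have deg: "n = Polynomial.degree q'"
    using Suc.hyps(2) q'0 degree_mult_eq[of "[:- z, 1:]" q'] unfolding q' by simp
  have nz: "av w \<noteq> 1" if "poly q' w = 0" for w
    using that Suc.prems(2)[of w] unfolding q' by simp
  from Suc.hyps(1)[OF deg q'0 nz]
  obtain s where "\<And>j. j \<noteq> s \<Longrightarrow> av (Polynomial.coeff q' j) < av (Polynomial.coeff q' s)" by blast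
  thus ?case unfolding q' by (rule dominant_coeff_linear_factor) (use Suc.prems(2) z in auto)
qed

end

text \<open>The weights are powers of one integer \<open>L\<close>. Each \<open>v\<close> gives a
  nonzero integer polynomial in \<open>L\<close>, and the product of these has only finitely many
  roots.\<close>

lemma separating_exponents:
  fixes V :: "(int^'d) set"
  assumes "finite V" "0 \<notin> V"
  shows "\<exists>e :: 'd \<Rightarrow> int. \<forall>v\<in>V. (\<Sum>i\<in>UNIV. v $ i * e i) \<noteq> 0"
proof -
  obtain idx :: "'d \<Rightarrow> nat" where idx: "inj idx"
    using finite_imp_inj_to_nat_seg[of "UNIV :: 'd set"] by auto
  define P where "P = (\<lambda>v::int^'d. \<Sum>i\<in>UNIV. Polynomial.monom (v $ i) (idx i))"
  have "P v \<noteq> 0" if "v \<in> V" for v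
  proof -
    from that assms have "v \<noteq> 0" by auto
    then obtain i where i: "v $ i \<noteq> 0" by (auto simp: Finite_Cartesian_Product.vec_eq_iff)
    have "Polynomial.coeff (P v) (idx i) = (\<Sum>j\<in>UNIV. if j = i then v $ j else 0)"
      unfolding P_def coeff_sum using idx by (intro sum.cong) (auto dest: injD)
    with i show ?thesis by auto
  qed
  hence "(\<Prod>v\<in>V. P v) \<noteq> 0" using assms by (simp add: prod_zero_iff)
  hence "finite {x. poly (\<Prod>v\<in>V. P v) x = 0}" by (rule poly_roots_finite)
  hence "finite (int -` {x. poly (\<Prod>v\<in>V. P v) x = 0})" by (intro finite_vimageI) auto
  then obtain L :: nat where L: "poly (\<Prod>v\<in>V. P v) (int L) \<noteq> 0"
    using ex_new_if_finite[OF infinite_UNIV_nat] by blast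
  have "(\<Sum>i\<in>UNIV. v $ i * int L ^ idx i) \<noteq> 0" if "v \<in> V" for v
    using L that assms by (auto simp: poly_prod P_def poly_sum poly_monom)
  thus ?thesis by (intro exI[of _ "\<lambda>i. int L ^ idx i"]) simp
qed

lemma power_int_sum_distrib:
  fixes w :: "'a::field"
  shows "finite A \<Longrightarrow> w \<noteq> 0 \<Longrightarrow> w powi (sum f A) = (\<Prod>i\<in>A. w powi f i)"
  by (induction A rule: finite_induct) (auto simp: power_int_add)

context Cp_field begin

text \<open>Restrict the Laurent polynomial to a one-parameter subgroup of the torus whose weights separate
  the exponents.\<close>
lemma dominant_laurent_coeff:
  fixes a :: "int^'d \<Rightarrow> int"
  assumes fin: "finite {\<nu>. a \<nu> \<noteq> 0}"
    and nz: "\<forall>z\<in>padic_torus av. laurent_eval a z \<noteq> (0::'k)"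
  shows "\<exists>\<mu>. \<forall>\<nu>. \<nu> \<noteq> \<mu> \<longrightarrow> av (of_int (a \<nu>)) < av (of_int (a \<mu>))"
proof -
  define S where "S = {\<nu>. a \<nu> \<noteq> 0}"
  have finS: "finite S" using fin by (simp add: S_def)
  \<comment> \<open>Weights that vanish on no difference of two exponents are injective on the
    support.\<close>
  define V where "V = (\<lambda>(\<nu>, \<mu>). \<nu> - \<mu>) ` (S \<times> S) - {0}"
  have "finite V" "0 \<notin> V" using finS by (auto simp: V_def)
  from separating_exponents[OF this] obtain e :: "'d \<Rightarrow> int"
    where e: "\<forall>v\<in>V. (\<Sum>i\<in>UNIV. v $ i * e i) \<noteq> 0" ..
  define \<phi> where "\<phi> = (\<lambda>\<nu>::int^'d. \<Sum>i\<in>UNIV. \<nu> $ i * e i)"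
  have \<phi>_inj: "\<nu> = \<mu>" if "\<nu> \<in> S" "\<mu> \<in> S" "\<phi> \<nu> = \<phi> \<mu>" for \<nu> \<mu>
  proof (rule ccontr)
    assume "\<nu> \<noteq> \<mu>"
    hence "\<nu> - \<mu> \<in> V" using that unfolding V_def by force
    with e have "(\<Sum>i\<in>UNIV. (\<nu> - \<mu>) $ i * e i) \<noteq> 0" by blast
    with that(3) show False by (simp add: \<phi>_def left_diff_distrib sum_subtractf)
  qed
  \<comment> \<open>A shift that makes all weighted exponents nonnegative, so that the restriction
    becomes a polynomial \<open>q\<close> with the same coefficients.\<close>
  define m where "m = (\<Sum>\<nu>\<in>S. \<bar>\<phi> \<nu>\<bar>)"
  have m: "\<phi> \<nu> + m \<ge> 0" if "\<nu> \<in> S" for \<nu>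
    using member_le_sum[of \<nu> S "\<lambda>\<nu>. \<bar>\<phi> \<nu>\<bar>"] that finS unfolding m_def by auto
  define n where "n = (\<lambda>\<nu>. nat (\<phi> \<nu> + m))"
  have n_inj: "\<nu> = \<mu>" if "\<nu> \<in> S" "\<mu> \<in> S" "n \<nu> = n \<mu>" for \<nu> \<mu>
    using \<phi>_inj[of \<nu> \<mu>] m[of \<nu>] m[of \<mu>] that by (auto simp: n_def)
  define q :: "'k poly" where "q = (\<Sum>\<nu>\<in>S. Polynomial.monom (of_int (a \<nu>)) (n \<nu>))"
  have coeff_n: "Polynomial.coeff q (n \<mu>) = of_int (a \<mu>)" if "\<mu> \<in> S" for \<mu>
  proof -
    have "Polynomial.coeff q (n \<mu>) = (\<Sum>\<nu>\<in>S. if \<nu> = \<mu> then of_int (a \<nu>) else 0)"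
      unfolding q_def coeff_sum using that by (intro sum.cong) (auto dest: n_inj)
    thus ?thesis using that finS by simp
  qed
  have coeff_0: "Polynomial.coeff q j = 0" if "j \<notin> n ` S" for j
    unfolding q_def coeff_sum using that by (intro sum.neutral) auto
  \<comment> \<open>The all-ones point lies on the torus, so the support is not empty.\<close>
  have nz1: "laurent_eval a (\<chi> i. 1) \<noteq> (0::'k)" using nz by (auto simp: padic_torus_def)
  have "S \<noteq> {}"
  proof
    assume "S = {}"
    hence "laurent_eval a (\<chi> i. 1) = (0::'k)" by (simp only: laurent_eval_def S_def sum.empty)
    with nz1 show False by contradiction
  qed
  then obtain \<mu>0 where "\<mu>0 \<in> S" by blast
  hence "Polynomial.coeff q (n \<mu>0) \<noteq> 0" using coeff_n of_int_neq_0 by (simp add: S_def)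
  hence q0: "q \<noteq> 0" by auto
  have "av w \<noteq> 1" if "poly q w = 0" for w
  proof
    assume w: "av w = 1"
    hence w0: "w \<noteq> 0" by auto
    \<comment> \<open>The image of \<open>w\<close> under the one-parameter subgroup; a root
      \<open>w\<close> of absolute value 1 would give a zero on the torus.\<close>
    define z :: "'k^'d" where "z = (\<chi> i. w powi e i)"
    have "z \<in> padic_torus av" by (simp add: padic_torus_def z_def av_powi w)
    hence "laurent_eval a z \<noteq> 0" using nz by blast
    moreover have "poly q w = w powi m * laurent_eval a z"
    proof -
      have "poly q w = (\<Sum>\<nu>\<in>S. of_int (a \<nu>) * w ^ n \<nu>)"
        by (simp add: q_def poly_sum poly_monom)
      also have "\<dots> = (\<Sum>\<nu>\<in>S. w powi m * (of_int (a \<nu>) * (\<Prod>i\<in>UNIV. (z $ i) powi (\<nu> $ i))))"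
      proof (rule sum.cong[OF refl])
        fix \<nu> assume "\<nu> \<in> S"
        hence "w ^ n \<nu> = w powi (m + \<phi> \<nu>)"
          using m[of \<nu>] by (simp add: n_def power_int_def add.commute)
        also have "\<dots> = w powi m * (\<Prod>i\<in>UNIV. w powi (\<nu> $ i * e i))"
          using w0 by (simp add: power_int_add \<phi>_def power_int_sum_distrib)
        also have "(\<Prod>i\<in>UNIV. w powi (\<nu> $ i * e i)) = (\<Prod>i\<in>UNIV. (z $ i) powi (\<nu> $ i))"
          by (simp add: z_def power_int_mult mult.commute[of "\<nu> $ _"])
        finally show "of_int (a \<nu>) * w ^ n \<nu>
          = w powi m * (of_int (a \<nu>) * (\<Prod>i\<in>UNIV. (z $ i) powi (\<nu> $ i)))" by simp
      qed
      finally show ?thesis by (simp add: laurent_eval_def S_def sum_distrib_left)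
    qed
    ultimately show False using that w0 by simp
  qed
  then obtain s where s: "\<And>j. j \<noteq> s \<Longrightarrow> av (Polynomial.coeff q j) < av (Polynomial.coeff q s)"
    using dominant_coeff_exists[OF q0] by blast
  \<comment> \<open>A strictly dominant coefficient is nonzero, so its index comes from the
    support.\<close>
  have "s \<in> n ` S"
    using s[of "Suc s"] coeff_0[of s] av_nonneg[of "Polynomial.coeff q (Suc s)"] by (cases "s \<in> n ` S") auto
  then obtain \<mu> where \<mu>: "\<mu> \<in> S" "s = n \<mu>" by blast
  show ?thesis
  proof (intro exI allI impI)
    fix \<nu> assume "\<nu> \<noteq> \<mu>"
    show "av (of_int (a \<nu>)) < av (of_int (a \<mu>))"
    proof (cases "\<nu> \<in> S")
      case True
      thus ?thesis using s[of "n \<nu>"] \<mu> coeff_n n_inj \<open>\<nu> \<noteq> \<mu>\<close> by metis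
    next
      case False
      thus ?thesis using of_int_neq_0[of "a \<mu>"] \<mu> by (auto simp: S_def order_less_le)
    qed
  qed
qed

end

section \<open>Roots of unity\<close>

context Cp_field begin

text \<open>A split-off root \<open>z\<close> is not a root of the cofactor, since the derivative of
  \<open>q\<close> at \<open>z\<close> is the value of the cofactor there; hence each linear factor
  contributes a new root.\<close>

lemma card_roots_eq_degree:
  fixes q :: "'k poly"
  assumes "q \<noteq> 0" "\<And>z. poly q z = 0 \<Longrightarrow> poly (pderiv q) z \<noteq> 0"
  shows "card {z. poly q z = 0} = Polynomial.degree q"
  using assms
proof (induction "Polynomial.degree q" arbitrary: q)
  case 0
  then obtain c where "q = [:c:]" by (metis degree_eq_zeroE)
  with 0 show ?case by simp
next
  case (Suc n)
  then obtain z where z: "poly q z = 0" using alg_closed[of q] by auto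
  then obtain q' where q': "q = [:- z, 1:] * q'" by (metis poly_eq_0_iff_dvd dvdE)
  have q'0: "q' \<noteq> 0" using Suc.prems(1) q' by auto
  have deg: "n = Polynomial.degree q'"
    using Suc.hyps(2) q'0 degree_mult_eq[of "[:- z, 1:]" q'] unfolding q' by simp
  have deriv: "poly (pderiv q) w = poly q' w + (w - z) * poly (pderiv q') w" for w
    unfolding q' pderiv_mult by (simp add: pderiv_pCons algebra_simps)
  have "poly q' z \<noteq> 0" using Suc.prems(2)[OF z] deriv[of z] by simp
  moreover have "card {w. poly q' w = 0} = Polynomial.degree q'"
  proof (rule Suc.hyps(1)[OF deg q'0])
    fix w assume "poly q' w = 0"
    thus "poly (pderiv q') w \<noteq> 0"
      using Suc.prems(2)[of w] deriv[of w] unfolding q' by auto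
  qed
  moreover have "{w. poly q w = 0} = insert z {w. poly q' w = 0}" unfolding q' by auto
  ultimately show ?case using poly_roots_finite[OF q'0] Suc.hyps(2) deg by simp
qed

text \<open>The derivative of \<open>X ^ N - 1\<close> is \<open>N * X ^ (N - 1)\<close>, which is
  nonzero at the roots because these are nonzero and \<open>of_nat N\<close> does not vanish in the
  field.\<close>

lemma roots_of_unity:
  assumes "N > 0"
  shows "finite {w::'k. w ^ N = 1}" "card {w::'k. w ^ N = 1} = N"
proof -
  define q :: "'k poly" where "q = Polynomial.monom 1 N - 1"
  have roots: "{w. w ^ N = 1} = {w. poly q w = 0}" by (simp add: q_def poly_monom)
  have "Polynomial.coeff q N = 1" using assms by (simp add: q_def)
  hence q0: "q \<noteq> 0" by auto
  show "finite {w::'k. w ^ N = 1}" unfolding roots by (rule poly_roots_finite[OF q0])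
  have "Polynomial.degree q = N"
  proof (rule antisym)
    show "Polynomial.degree q \<le> N"
      unfolding q_def by (intro degree_diff_le degree_monom_le) simp
    show "N \<le> Polynomial.degree q" using \<open>Polynomial.coeff q N = 1\<close> by (intro le_degree) simp
  qed
  moreover have "poly (pderiv q) w \<noteq> 0" if "poly q w = 0" for w
  proof -
    from that have "w ^ N = 1" by (simp add: q_def poly_monom)
    hence "w \<noteq> 0" using assms by (auto simp: power_0_left)
    thus ?thesis using of_nat_neq_0[OF assms] by (simp add: q_def pderiv_diff pderiv_monom poly_monom)
  qed
  ultimately show "card {w::'k. w ^ N = 1} = N"
    unfolding roots using card_roots_eq_degree[OF q0] by simp
qed

lemma sum_roots_of_unity_powi:
  assumes N: "N > 0"
  shows "(\<Sum>w | w ^ N = 1. w powi j) = (if int N dvd j then of_nat N else (0::'k))"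
proof -
  let ?U = "{w::'k. w ^ N = 1}"
  have nz: "w \<noteq> 0" if "w \<in> ?U" for w using that N by (auto simp: power_0_left)
  have powi_N: "w powi (int N * i) = 1" if "w \<in> ?U" for w i
    using that by (simp add: power_int_mult)
  show ?thesis
  proof (cases "int N dvd j")
    case True
    then obtain i where "j = int N * i" by blast
    hence "(\<Sum>w\<in>?U. w powi j) = (\<Sum>w\<in>?U. 1)" using powi_N by (intro sum.cong) auto
    thus ?thesis using True roots_of_unity[OF N] by simp
  next
    case False
    define r where "r = nat (j mod int N)"
    have "j mod int N \<noteq> 0" using False by (simp add: dvd_eq_mod_eq_0)
    moreover have "0 \<le> j mod int N" "j mod int N < int N" using N by simp_all
    ultimately have r: "0 < r" "r < N" unfolding r_def by linarith+
    have powi_j: "w powi j = w ^ r" if "w \<in> ?U" for w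
    proof -
      have "j = int N * (j div int N) + int r" using N by (simp add: r_def)
      hence "w powi j = w powi (int N * (j div int N)) * w powi int r"
        using nz[OF that] by (metis power_int_add)
      thus ?thesis using powi_N[OF that] by simp
    qed
    \<comment> \<open>Only \<open>r < N\<close> elements satisfy \<open>w ^ r = 1\<close>, so some
      \<open>N\<close>-th root of unity \<open>w0\<close> is not among them.\<close>
    have "\<not> ?U \<subseteq> {w. w ^ r = 1}"
      using card_mono[OF roots_of_unity(1)[OF r(1)], of ?U] roots_of_unity(2) N r by auto
    then obtain w0 where w0: "w0 \<in> ?U" "w0 ^ r \<noteq> 1" by blast
    \<comment> \<open>Translation by \<open>w0\<close> multiplies the sum by
      \<open>w0 ^ r \<noteq> 1\<close>, so the sum is 0.\<close>
    have "bij_betw (\<lambda>w. w0 * w) ?U ?U"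
      using w0(1) nz[OF w0(1)]
      by (intro bij_betwI[where g = "\<lambda>w. w / w0"]) (auto simp: power_mult_distrib power_divide)
    hence "(\<Sum>w\<in>?U. w powi j) = (\<Sum>w\<in>?U. (w0 * w) powi j)"
      by (rule sum.reindex_bij_betw[symmetric])
    also have "\<dots> = w0 ^ r * (\<Sum>w\<in>?U. w powi j)"
      using powi_j[OF w0(1)] by (simp add: power_int_mult_distrib sum_distrib_left)
    finally have "w0 ^ r * (\<Sum>w\<in>?U. w powi j) = (\<Sum>w\<in>?U. w powi j)" by (rule sym)
    hence "(w0 ^ r - 1) * (\<Sum>w\<in>?U. w powi j) = 0" by (simp add: left_diff_distrib)
    hence "(\<Sum>w\<in>?U. w powi j) = 0" using w0(2) by simp
    thus ?thesis using False by simp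
  qed
qed

lemma roots_of_unity_vec:
  assumes "N > 0"
  shows "bij_betw vec_lambda (UNIV \<rightarrow>\<^sub>E {w::'k. w ^ N = 1}) {\<zeta> :: 'k^'d. \<forall>i. (\<zeta> $ i) ^ N = 1}"
  by (rule bij_betwI[where g = vec_nth]) (auto simp: vec_lambda_eta)

text \<open>The sum over the product group factors into sums over the single coordinates.\<close>

lemma sum_roots_of_unity_vec:
  fixes \<nu> :: "int^'d"
  assumes N: "N > 0"
  shows "(\<Sum>\<zeta> | \<forall>i. (\<zeta> $ i) ^ N = 1. \<Prod>i\<in>UNIV. (\<zeta> $ i) powi (\<nu> $ i))
       = of_nat N ^ CARD('d) * (of_bool (\<forall>i. int N dvd \<nu> $ i) :: 'k)" (is "?L = ?R")
proof -
  have "?L = (\<Sum>g\<in>UNIV \<rightarrow>\<^sub>E {w::'k. w ^ N = 1}. \<Prod>i\<in>UNIV. g i powi (\<nu> $ i))"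
    using sum.reindex_bij_betw[OF roots_of_unity_vec[OF N],
        of "\<lambda>\<zeta>. \<Prod>i\<in>UNIV. (\<zeta> $ i) powi (\<nu> $ i)"] by simp
  also have "\<dots> = (\<Prod>i\<in>UNIV. \<Sum>w | w ^ N = 1. w powi (\<nu> $ i))"
    using roots_of_unity(1)[OF N] by (intro prod_sum_PiE[symmetric]) auto
  also have "\<dots> = (\<Prod>i\<in>(UNIV::'d set). if int N dvd \<nu> $ i then of_nat N else 0)"
    by (simp only: sum_roots_of_unity_powi[OF N])
  also have "\<dots> = ?R"
  proof (cases "\<forall>i. int N dvd \<nu> $ i")
    case False
    hence "(\<Prod>i\<in>(UNIV::'d set). if int N dvd \<nu> $ i then of_nat N else 0) = (0::'k)"
      by (intro prod_zero) auto
    with False show ?thesis by simp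
  qed simp
  finally show ?thesis .
qed

end

section \<open>Integral group rings\<close>

text \<open>One notion for evaluation at a point (\<open>\<phi>\<close> multiplicative), for a
  coefficient or a sum of coefficients over a set (\<open>\<phi>\<close> an indicator), and for the
  entries of convolution matrices.\<close>

definition linear_extension :: "('g \<Rightarrow> 'b::comm_ring_1) \<Rightarrow> ('g \<Rightarrow>\<^sub>0 int) \<Rightarrow> 'b" where
  "linear_extension \<phi> f = (\<Sum>\<nu>\<in>Poly_Mapping.keys f. of_int (Poly_Mapping.lookup f \<nu>) * \<phi> \<nu>)"

lemma linear_extension_0 [simp]: "linear_extension \<phi> 0 = 0"
  by (simp add: linear_extension_def)

lemma linear_extension_add:
  "linear_extension \<phi> (f + g) = linear_extension \<phi> f + linear_extension \<phi> g"
  unfolding linear_extension_def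
  by (rule Poly_Mapping.setsum_keys_plus_distrib) (auto simp: algebra_simps)

lemma linear_extension_single [simp]:
  "linear_extension \<phi> (Poly_Mapping.single \<nu> c) = of_int c * \<phi> \<nu>"
  by (simp add: linear_extension_def)

lemma linear_extension_fun_cmult:
  "linear_extension (\<lambda>\<nu>. c * \<phi> \<nu>) f = c * linear_extension \<phi> f"
  by (simp add: linear_extension_def sum_distrib_left mult.left_commute)

lemma linear_extension_fun_sum:
  "linear_extension (\<lambda>\<nu>. \<Sum>i\<in>I. \<phi> i \<nu>) f = (\<Sum>i\<in>I. linear_extension (\<phi> i) f)"
  unfolding linear_extension_def sum_distrib_left by (rule sum.swap)

lemma poly_mapping_additive_induct [case_names zero single add]:
  assumes "P 0" "\<And>k c. P (Poly_Mapping.single k c)" "\<And>f g. P f \<Longrightarrow> P g \<Longrightarrow> P (f + g)"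
  shows "P (f :: 'a \<Rightarrow>\<^sub>0 'b::comm_monoid_add)"
proof (induction f rule: Poly_Mapping.update_induct)
  case (update f a b)
  have "Poly_Mapping.update a b f = Poly_Mapping.single a b + f"
    using update(1) by (intro poly_mapping_eqI)
      (auto simp: lookup_update lookup_add lookup_single when_def in_keys_iff)
  thus ?case using assms update by simp
qed (rule assms)

text \<open>Both sides are additive in \<open>f\<close> and in \<open>g\<close>, so it suffices to
  multiply two monomials.\<close>

lemma linear_extension_mult:
  fixes f g :: "'g::comm_monoid_add \<Rightarrow>\<^sub>0 int"
  shows "linear_extension \<phi> (f * g)
      = linear_extension (\<lambda>\<nu>. linear_extension (\<lambda>\<mu>. \<phi> (\<nu> + \<mu>)) g) f"
proof (induction f rule: poly_mapping_additive_induct)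
  case (single k c)
  show ?case
    by (induction g rule: poly_mapping_additive_induct)
       (simp_all add: mult_single linear_extension_add algebra_simps)
qed (simp_all add: linear_extension_add distrib_right)

lemma linear_extension_one [simp]:
  "linear_extension \<phi> (1 :: 'g::comm_monoid_add \<Rightarrow>\<^sub>0 int) = \<phi> 0"
  by (simp flip: single_one)

lemma linear_extension_of_int_mult:
  fixes f :: "'g::comm_monoid_add \<Rightarrow>\<^sub>0 int"
  shows "linear_extension \<phi> (of_int c * f) = of_int c * linear_extension \<phi> f"
  by (simp add: linear_extension_mult flip: single_of_int)

lemma linear_extension_of_nat_mult:
  fixes f :: "'g::comm_monoid_add \<Rightarrow>\<^sub>0 int"
  shows "linear_extension \<phi> (of_nat c * f) = of_nat c * linear_extension \<phi> f"
  using linear_extension_of_int_mult[of \<phi> "int c" f] by simp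

lemma linear_extension_hom_mult:
  fixes f g :: "'g::comm_monoid_add \<Rightarrow>\<^sub>0 int"
  assumes "\<And>\<nu> \<mu>. \<phi> (\<nu> + \<mu>) = \<phi> \<nu> * \<phi> \<mu>"
  shows "linear_extension \<phi> (f * g) = linear_extension \<phi> f * linear_extension \<phi> g"
proof -
  have "linear_extension \<phi> (f * g) = linear_extension (\<lambda>\<nu>. linear_extension \<phi> g * \<phi> \<nu>) f"
    by (simp add: linear_extension_mult assms linear_extension_fun_cmult mult.commute)
  thus ?thesis using linear_extension_fun_cmult[of "linear_extension \<phi> g" \<phi> f]
    by (simp add: mult.commute)
qed

lemma linear_extension_hom_power:
  fixes f :: "'g::comm_monoid_add \<Rightarrow>\<^sub>0 int"
  assumes "\<And>\<nu> \<mu>. \<phi> (\<nu> + \<mu>) = \<phi> \<nu> * \<phi> \<mu>" "\<phi> 0 = 1"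
  shows "linear_extension \<phi> (f ^ n) = linear_extension \<phi> f ^ n"
  by (induction n) (simp_all add: assms linear_extension_hom_mult[of \<phi>])

lemma lookup_eq_linear_extension:
  "Poly_Mapping.lookup f k = linear_extension (\<lambda>\<nu>. of_bool (\<nu> = k)) f"
  by (simp add: linear_extension_def in_keys_iff of_bool_def if_distrib sum.delta cong: if_cong)

text \<open>As \<open>(1 + t) ^ p\<close> is \<open>1 + p * t\<close> up to a multiple of
  \<open>t\<^sup>2\<close>, the \<open>p\<close>-th power of \<open>1 + p ^ (n + 1) * h\<close> is
  \<open>1 + p ^ (n + 2) * h'\<close> with \<open>h' - h\<close> a multiple of \<open>p ^ n\<close>.
  The second conjunct makes the coefficients of \<open>e\<close> converge at a common rate.\<close>

lemma one_plus_power_p_power: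
  fixes y :: "'a::comm_ring_1"
  shows "\<exists>e w. \<forall>n. (1 + of_nat p * y) ^ (p ^ n) = 1 + of_nat (p ^ n) * e n
                 \<and> e (Suc n) = e n + of_nat (p ^ Suc n) * w n"
proof -
  have "\<exists>r. (1 + t) ^ p = 1 + of_nat p * t + t\<^sup>2 * r" for t :: 'a
  proof (induction p)
    case (Suc p)
    then obtain r where "(1 + t) ^ p = 1 + of_nat p * t + t\<^sup>2 * r" by blast
    hence "(1 + t) ^ Suc p = 1 + of_nat (Suc p) * t + t\<^sup>2 * (of_nat p + r + t * r)"
      by (simp add: algebra_simps power2_eq_square)
    thus ?case by blast
  qed (auto intro: exI[of _ 0])
  then obtain r where r: "\<And>t::'a. (1 + t) ^ p = 1 + of_nat p * t + t\<^sup>2 * r t" by metis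
  define v where "v = (\<lambda>n h. h\<^sup>2 * r (of_nat (p ^ Suc n) * h))"
  define h where "h = rec_nat y (\<lambda>n h. h + of_nat (p ^ n) * v n h)"
  have h: "h 0 = y" "h (Suc n) = h n + of_nat (p ^ n) * v n (h n)" for n
    by (simp_all add: h_def)
  have pow: "(1 + of_nat p * y) ^ (p ^ n) = 1 + of_nat (p ^ Suc n) * h n" for n
  proof (induction n)
    case (Suc n)
    have "(1 + of_nat p * y) ^ (p ^ Suc n) = ((1 + of_nat p * y) ^ (p ^ n)) ^ p"
      by (simp add: power_mult[symmetric] mult.commute)
    also have "\<dots> = (1 + of_nat (p ^ Suc n) * h n) ^ p" unfolding Suc.IH ..
    also have "\<dots> = 1 + of_nat p * (of_nat (p ^ Suc n) * h n)
        + (of_nat (p ^ Suc n) * h n)\<^sup>2 * r (of_nat (p ^ Suc n) * h n)"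
      by (rule r)
    also have "\<dots> = 1 + of_nat (p ^ Suc (Suc n)) * h (Suc n)"
      by (simp add: h v_def algebra_simps power2_eq_square)
    finally show ?case .
  qed (simp add: h)
  show ?thesis
    \<comment> \<open>\<open>e n\<close> is normalised by \<open>p ^ n\<close> but
      \<open>h n\<close> by \<open>p ^ Suc n\<close>; the resulting factor \<open>p\<close> also
      raises the divisibility of the increments to \<open>p ^ Suc n\<close>.\<close>
    by (rule exI[of _ "\<lambda>n. of_nat p * h n"], rule exI[of _ "\<lambda>n. v n (h n)"])
       (use pow in \<open>simp add: h algebra_simps\<close>)
qed

section \<open>Determinants over finite quotients of the group\<close>

text \<open>Numbering the cosets of \<open>H\<close> lets multiplication on the group ring of the
  quotient be written as an integer matrix.\<close>

locale finite_index_subgroup =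
  fixes H :: "'g::ab_group_add set" and m :: nat and idx :: "'g \<Rightarrow> nat" and rep :: "nat \<Rightarrow> 'g"
  assumes idx_less: "idx \<gamma> < m"
    and idx_rep: "i < m \<Longrightarrow> idx (rep i) = i"
    and idx_eq_iff: "idx \<gamma> = idx \<delta> \<longleftrightarrow> \<gamma> - \<delta> \<in> H"
begin

lemma idx_rep_idx_add: "idx (rep (idx \<gamma>) + \<nu>) = idx (\<gamma> + \<nu>)"
  using idx_eq_iff idx_rep[OF idx_less] by (metis add_diff_cancel_right)

text \<open>The matrix of multiplication by the image of \<open>f\<close> on the group ring of the
  quotient by \<open>H\<close>, in the basis of cosets: row \<open>i\<close> expands the product of
  coset \<open>i\<close> with \<open>f\<close>.\<close>

definition conv_mat :: "('g \<Rightarrow>\<^sub>0 int) \<Rightarrow> int mat" where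
  "conv_mat f = Matrix.mat m m
     (\<lambda>(i,j). linear_extension (\<lambda>\<nu>. of_bool (idx (rep i + \<nu>) = j)) f)"

lemma conv_mat_carrier [simp]: "conv_mat f \<in> carrier_mat m m"
  by (simp add: conv_mat_def)

lemma conv_mat_index:
  "i < m \<Longrightarrow> j < m \<Longrightarrow>
    conv_mat f $$ (i,j) = linear_extension (\<lambda>\<nu>. of_bool (idx (rep i + \<nu>) = j)) f"
  by (simp add: conv_mat_def)

lemma conv_mat_mult: "conv_mat (f * g) = conv_mat f * conv_mat g"
proof (rule eq_matI)
  fix i j assume "i < dim_row (conv_mat f * conv_mat g)" "j < dim_col (conv_mat f * conv_mat g)"
  hence i: "i < m" and j: "j < m" by (simp_all add: conv_mat_def)
  \<comment> \<open>The inner functional depends on \<open>\<nu>\<close> only through the coset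
    \<open>l\<close> of \<open>rep i + \<nu>\<close>, which is the summation index of the matrix
    product.\<close>
  have "linear_extension (\<lambda>\<mu>. of_bool (idx (rep i + (\<nu> + \<mu>)) = j)) g
      = (\<Sum>l<m. conv_mat g $$ (l,j) * of_bool (idx (rep i + \<nu>) = l))" for \<nu>
  proof -
    have "(\<Sum>l<m. conv_mat g $$ (l,j) * of_bool (idx (rep i + \<nu>) = l))
        = conv_mat g $$ (idx (rep i + \<nu>), j)"
      using idx_less by (simp add: of_bool_def if_distrib sum.delta cong: if_cong)
    thus ?thesis using idx_less j by (simp add: conv_mat_index idx_rep_idx_add add.assoc)
  qed
  hence "conv_mat (f * g) $$ (i,j)
      = linear_extension (\<lambda>\<nu>. \<Sum>l<m. conv_mat g $$ (l,j) * of_bool (idx (rep i + \<nu>) = l)) f"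
    using i j by (simp add: conv_mat_index linear_extension_mult)
  also have "\<dots> = (\<Sum>l<m. conv_mat g $$ (l,j)
      * linear_extension (\<lambda>\<nu>. of_bool (idx (rep i + \<nu>) = l)) f)"
    by (simp only: linear_extension_fun_sum linear_extension_fun_cmult)
  also have "\<dots> = (\<Sum>l<m. conv_mat f $$ (i,l) * conv_mat g $$ (l,j))"
    using i by (intro sum.cong) (simp_all add: conv_mat_index mult.commute)
  also have "\<dots> = (conv_mat f * conv_mat g) $$ (i,j)"
    using i j by (simp add: conv_mat_def scalar_prod_def atLeast0LessThan)
  finally show "conv_mat (f * g) $$ (i,j) = (conv_mat f * conv_mat g) $$ (i,j)" .
qed (simp_all add: conv_mat_def)

definition det_conv :: "('g \<Rightarrow>\<^sub>0 int) \<Rightarrow> int" where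
  "det_conv f = Determinant.det (conv_mat f)"

lemma det_conv_mult: "det_conv (f * g) = det_conv f * det_conv g"
  unfolding det_conv_def conv_mat_mult by (rule det_mult[of _ m]) simp_all

lemma det_conv_of_int: "det_conv (of_int c) = c ^ m"
proof -
  have "conv_mat (of_int c) = c \<cdot>\<^sub>m 1\<^sub>m m"
    by (rule eq_matI) (auto simp: conv_mat_def idx_rep simp flip: single_of_int)
  thus ?thesis by (simp add: det_conv_def)
qed

lemma det_conv_1 [simp]: "det_conv 1 = 1"
  using det_conv_of_int[of 1] by simp

lemma det_conv_power: "det_conv (f ^ n) = det_conv f ^ n"
  by (induction n) (simp_all add: det_conv_mult)

text \<open>A monomial is invertible in the integral group ring, so its determinant is a unit of
  \<open>\<int>\<close>.\<close>

lemma abs_det_conv_single: "\<bar>det_conv (Poly_Mapping.single \<nu> 1)\<bar> = 1"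
proof -
  have "det_conv (Poly_Mapping.single \<nu> 1) * det_conv (Poly_Mapping.single (- \<nu>) 1) = 1"
    by (simp flip: det_conv_mult add: mult_single)
  thus ?thesis by (auto simp: zmult_eq_1_iff)
qed

text \<open>Translation by \<open>\<nu>\<close> maps coset \<open>i\<close> to itself exactly if
  \<open>\<nu> \<in> H\<close>, so all diagonal entries of \<open>conv_mat f\<close> equal the sum
  of the coefficients over \<open>H\<close>, and the trace is \<open>m\<close> times that
  sum.\<close>

lemma det_conv_one_plus:
  "x\<^sup>2 dvd det_conv (1 + of_int x * f)
      - (1 + x * (int m * linear_extension (\<lambda>\<nu>. of_bool (\<nu> \<in> H)) f))"
proof -
  let ?c = "\<lambda>i j. linear_extension (\<lambda>\<nu>. of_bool (idx (rep i + \<nu>) = j)) f"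
  have "conv_mat (1 + of_int x * f) = Matrix.mat m m (\<lambda>(i,j). of_bool (i = j) + x * ?c i j)"
    by (rule eq_matI)
      (auto simp: conv_mat_def linear_extension_add linear_extension_of_int_mult idx_rep)
  moreover have "(\<Sum>i<m. ?c i i) = int m * linear_extension (\<lambda>\<nu>. of_bool (\<nu> \<in> H)) f"
  proof -
    have "idx (rep i + \<nu>) = i \<longleftrightarrow> \<nu> \<in> H" if "i < m" for i \<nu>
      using idx_eq_iff[of "rep i + \<nu>" "rep i"] idx_rep[OF that] by simp
    thus ?thesis by simp
  qed
  ultimately show ?thesis using det_one_plus_mult[of x m ?c] by (simp add: det_conv_def)
qed

end

section \<open>Entropy and Mahler measure\<close>

lemma (in finite_index_subgroup) index_pos: "m > 0"
  using idx_less[of 0] by simp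

section \<open>Fixed points of finite-index subgroups\<close>

lemma finite_index_subgroup_exists:
  fixes H :: "(int^'d) set"
  assumes H: "add_subgroup H" and fin: "finite (cosets_of H)"
  shows "\<exists>idx rep. finite_index_subgroup H (sub_index H) idx rep"
proof -
  define c where "c = (\<lambda>g. (\<lambda>y. g + y) ` H)"
  have cosets: "cosets_of H = range c" by (simp add: cosets_of_def c_def)
  have c_eq: "c \<gamma> = c \<delta> \<longleftrightarrow> \<gamma> - \<delta> \<in> H" for \<gamma> \<delta>
  proof
    assume "c \<gamma> = c \<delta>"
    moreover have "\<gamma> + 0 \<in> c \<gamma>" using H unfolding add_subgroup_def c_def by (intro imageI) simp
    ultimately obtain y where "y \<in> H" "\<gamma> = \<delta> + y" by (auto simp: c_def)
    thus "\<gamma> - \<delta> \<in> H" by simp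
  next
    have sub: "c \<gamma> \<subseteq> c \<delta>" if "\<gamma> - \<delta> \<in> H" for \<gamma> \<delta>
    proof
      fix x assume "x \<in> c \<gamma>"
      then obtain y where y: "y \<in> H" "x = \<gamma> + y" by (auto simp: c_def)
      hence "x = \<delta> + ((\<gamma> - \<delta>) + y)" "(\<gamma> - \<delta>) + y \<in> H"
        using that H by (auto simp: add_subgroup_def)
      thus "x \<in> c \<delta>" unfolding c_def by (rule image_eqI)
    qed
    assume "\<gamma> - \<delta> \<in> H"
    moreover from this have "- (\<gamma> - \<delta>) \<in> H" using H unfolding add_subgroup_def by blast
    ultimately show "c \<gamma> = c \<delta>" using sub[of \<gamma> \<delta>] sub[of \<delta> \<gamma>] by simp
  qed
  obtain b where b: "bij_betw b (range c) {0..<sub_index H}"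
    using ex_bij_betw_finite_nat[OF fin] unfolding sub_index_def cosets by blast
  define idx where "idx = (\<lambda>\<gamma>. b (c \<gamma>))"
  define rep where "rep = (\<lambda>i. SOME \<gamma>. idx \<gamma> = i)"
  have "finite_index_subgroup H (sub_index H) idx rep"
  proof
    show "idx \<gamma> < sub_index H" for \<gamma>
      using bij_betwE[OF b] by (auto simp: idx_def)
    show "idx (rep i) = i" if "i < sub_index H" for i
    proof -
      have "i \<in> b ` range c" using b that by (simp add: bij_betw_def)
      hence "\<exists>\<gamma>. idx \<gamma> = i" by (auto simp: idx_def)
      thus ?thesis unfolding rep_def by (rule someI_ex)
    qed
    show "idx \<gamma> = idx \<delta> \<longleftrightarrow> \<gamma> - \<delta> \<in> H" for \<gamma> \<delta>
      using c_eq inj_on_eq_iff[OF bij_betw_imp_inj_on[OF b] rangeI rangeI] by (simp add: idx_def)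
  qed
  thus ?thesis by blast
qed

text \<open>A point fixed by \<open>H\<close> is constant on cosets and so amounts to
  \<open>m\<close> numbers; the relations of \<open>X_f\<close> at the representatives are the rows
  of \<open>conv_mat f\<close>. The fixed points thus correspond to a
  \<open>torus_kernel\<close>.\<close>

lemma Fix_sub_card:
  fixes a :: "int^'d \<Rightarrow> int"
  assumes "finite_index_subgroup H m idx rep" and "add_subgroup H"
    and lookup: "Poly_Mapping.lookup f = a"
    and nz: "finite_index_subgroup.det_conv m idx rep f \<noteq> 0"
  shows "finite (Fix_sub H (X_f a))"
    and "int (card (Fix_sub H (X_f a))) = \<bar>finite_index_subgroup.det_conv m idx rep f\<bar>"
proof -
  interpret finite_index_subgroup H m idx rep by fact
  define L where "L = (\<lambda>x \<gamma>. \<Sum>\<nu>\<in>{\<nu>. a \<nu> \<noteq> 0}. real_of_int (a \<nu>) * x (\<gamma> + \<nu>))"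
  have keys: "Poly_Mapping.keys f = {\<nu>. a \<nu> \<noteq> 0}" using lookup by (auto simp: in_keys_iff)
  have delta: "(\<Sum>j<m. of_bool (idx \<gamma> = j) * y j) = y (idx \<gamma>)" for \<gamma> and y :: "nat \<Rightarrow> real"
  proof -
    have "(\<Sum>j<m. of_bool (idx \<gamma> = j) * y j) = (\<Sum>j<m. if j = idx \<gamma> then y j else 0)"
      by (intro sum.cong) auto
    thus ?thesis using idx_less by simp
  qed
  have L_idx: "L (\<lambda>\<gamma>. y (idx \<gamma>)) (rep i) = (\<Sum>j<m. real_of_int (conv_mat f $$ (i,j)) * y j)"
    if i: "i < m" for y :: "nat \<Rightarrow> real" and i
  proof -
    have of_int_le: "real_of_int (linear_extension \<phi> f)
        = (\<Sum>\<nu>\<in>{\<nu>. a \<nu> \<noteq> 0}. real_of_int (a \<nu>) * real_of_int (\<phi> \<nu>))" for \<phi>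
      by (simp add: linear_extension_def keys lookup)
    have "(\<Sum>j<m. real_of_int (conv_mat f $$ (i,j)) * y j)
        = (\<Sum>j<m. \<Sum>\<nu>\<in>{\<nu>. a \<nu> \<noteq> 0}. real_of_int (a \<nu>) * (of_bool (idx (rep i + \<nu>) = j) * y j))"
      using i by (intro sum.cong) (simp_all add: conv_mat_index of_int_le sum_distrib_right mult.assoc)
    also have "\<dots> = (\<Sum>\<nu>\<in>{\<nu>. a \<nu> \<noteq> 0}. real_of_int (a \<nu>) *
                       (\<Sum>j<m. of_bool (idx (rep i + \<nu>) = j) * y j))"
      by (subst sum.swap) (simp only: sum_distrib_left)
    also have "\<dots> = L (\<lambda>\<gamma>. y (idx \<gamma>)) (rep i)" unfolding L_def by (simp only: delta)
    finally show ?thesis ..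
  qed
  \<comment> \<open>The relation at an arbitrary \<open>\<gamma>\<close> repeats the one at the
    representative of its coset.\<close>
  have L_periodic: "L (\<lambda>\<gamma>. y (idx \<gamma>)) \<gamma> = L (\<lambda>\<gamma>. y (idx \<gamma>)) (rep (idx \<gamma>))" for y \<gamma>
    by (simp add: L_def idx_rep_idx_add)
  have Fix_iff: "x \<in> Fix_sub H (X_f a) \<longleftrightarrow>
      (\<forall>\<gamma>. 0 \<le> x \<gamma> \<and> x \<gamma> < 1) \<and> (\<forall>\<gamma>. L x \<gamma> \<in> \<int>) \<and> (\<forall>\<nu>\<in>H. \<forall>\<gamma>. x (\<gamma> - \<nu>) = x \<gamma>)" for x
    by (auto simp: Fix_sub_def X_f_def L_def)
  have rep_idx: "x (rep (idx \<gamma>)) = x \<gamma>" if "x \<in> Fix_sub H (X_f a)" for x \<gamma>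
  proof -
    have "\<gamma> - rep (idx \<gamma>) \<in> H" using idx_eq_iff[of \<gamma> "rep (idx \<gamma>)"] idx_rep idx_less by simp
    with that have "x (\<gamma> - (\<gamma> - rep (idx \<gamma>))) = x \<gamma>" unfolding Fix_iff by blast
    thus ?thesis by simp
  qed
  have bij: "bij_betw (\<lambda>x j. if j < m then x (rep j) else 0)
      (Fix_sub H (X_f a)) (torus_kernel m (conv_mat f))"
  proof (rule bij_betwI[where g = "\<lambda>y \<gamma>. y (idx \<gamma>)"], goal_cases)
    case 1
    show ?case
    proof
      fix x assume x: "x \<in> Fix_sub H (X_f a)"
      let ?y = "\<lambda>j. if j < m then x (rep j) else 0"
      have "x = (\<lambda>\<gamma>. ?y (idx \<gamma>))" using rep_idx[OF x] idx_less by auto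
      hence "L (\<lambda>\<gamma>. ?y (idx \<gamma>)) \<gamma> \<in> \<int>" for \<gamma> using x unfolding Fix_iff by metis
      hence "(\<Sum>j<m. real_of_int (conv_mat f $$ (i,j)) * ?y j) \<in> \<int>" if "i < m" for i
        using L_idx[OF that, of ?y] by metis
      thus "?y \<in> torus_kernel m (conv_mat f)"
        using x unfolding Fix_iff torus_kernel_def by simp
    qed
  next
    case 2
    show ?case
    proof
      fix y assume y: "y \<in> torus_kernel m (conv_mat f)"
      have "L (\<lambda>\<gamma>. y (idx \<gamma>)) \<gamma> \<in> \<int>" for \<gamma>
        using L_periodic[of y \<gamma>] L_idx[of "idx \<gamma>" y] idx_less[of \<gamma>] y
        unfolding torus_kernel_def by simp
      moreover have "idx (\<gamma> - \<nu>) = idx \<gamma>" if "\<nu> \<in> H" for \<nu> \<gamma>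
        using that assms(2) by (simp add: idx_eq_iff add_subgroup_def)
      ultimately show "(\<lambda>\<gamma>. y (idx \<gamma>)) \<in> Fix_sub H (X_f a)"
        using y idx_less unfolding Fix_iff torus_kernel_def by simp
    qed
  next
    case (3 x) thus ?case using rep_idx idx_less by auto
  next
    case (4 y) thus ?case by (auto simp: torus_kernel_def idx_rep)
  qed
  have K: "finite (torus_kernel m (conv_mat f))"
      "int (card (torus_kernel m (conv_mat f))) = \<bar>det_conv f\<bar>"
    using card_torus_kernel[OF conv_mat_carrier] nz unfolding det_conv_def by blast+
  show "finite (Fix_sub H (X_f a))" using bij_betw_finite[OF bij] K(1) by blast
  show "int (card (Fix_sub H (X_f a))) = \<bar>det_conv f\<bar>" using bij_betw_same_card[OF bij] K(2) by simp
qed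

section \<open>The shape of a power of the polynomial\<close>

lemma poly_mapping_dvd:
  fixes f :: "'g::comm_monoid_add \<Rightarrow>\<^sub>0 int"
  assumes "\<And>\<nu>. c dvd Poly_Mapping.lookup f \<nu>"
  shows "\<exists>g. f = of_int c * g"
proof -
  define g where "g = Abs_poly_mapping (\<lambda>\<nu>. Poly_Mapping.lookup f \<nu> div c)"
  have "finite {\<nu>. Poly_Mapping.lookup f \<nu> div c \<noteq> 0}"
    by (rule finite_subset[OF _ finite_lookup[of f]]) auto
  hence "Poly_Mapping.lookup g \<nu> = Poly_Mapping.lookup f \<nu> div c" for \<nu>
    by (simp add: g_def)
  moreover have "Poly_Mapping.lookup (of_int c * g) \<nu> = c * Poly_Mapping.lookup g \<nu>" for \<nu>
    by (simp add: lookup_eq_linear_extension linear_extension_of_int_mult)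
  ultimately have "f = of_int c * g" using assms by (intro poly_mapping_eqI) simp
  thus ?thesis by blast
qed

lemma single_power:
  fixes c :: "'b::comm_semiring_1" and \<mu> :: "'g::comm_monoid_add"
  shows "\<exists>\<mu>'. Poly_Mapping.single \<mu> c ^ n = Poly_Mapping.single \<mu>' (c ^ n)"
proof (induction n)
  case (Suc n)
  then obtain \<mu>' where "Poly_Mapping.single \<mu> c ^ n = Poly_Mapping.single \<mu>' (c ^ n)" by blast
  thus ?case by (auto simp: mult_single)
qed (auto intro: exI[of _ 0])

lemma power_add_mult_dvd:
  fixes x y z :: "'a::comm_ring_1"
  shows "\<exists>r. (x + y * z) ^ n = x ^ n + y * r"
proof (induction n)
  case (Suc n)
  then obtain r where "(x + y * z) ^ n = x ^ n + y * r" by blast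
  hence "(x + y * z) ^ Suc n = x ^ Suc n + y * (z * x ^ n + x * r + z * y * r)"
    by (simp add: algebra_simps)
  thus ?case by blast
qed (auto intro: exI[of _ 0])

context Cp_field begin

text \<open>The exponent \<open>2 * (p - 1)\<close> makes the unit part of the dominant coefficient congruent to \<open>1\<close>,
  and, being even, also removes the sign of the determinant of multiplication by \<open>f\<close>.\<close>
lemma nonvanishing_power_decomposition:
  fixes a :: "int^'d \<Rightarrow> int"
  assumes fin: "finite {\<nu>. a \<nu> \<noteq> 0}"
    and nz: "\<forall>z\<in>padic_torus av. laurent_eval a z \<noteq> (0::'k)"
    and lookup: "Poly_Mapping.lookup f = a"
  shows "\<exists>k \<mu> h. f ^ (2 * (p - 1)) =
      of_nat (p ^ k) * (Poly_Mapping.single \<mu> 1 ^ 2 * (1 + of_nat p * h))"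
proof -
  obtain \<mu> where \<mu>: "\<And>\<nu>. \<nu> \<noteq> \<mu> \<Longrightarrow> av (of_int (a \<nu>)) < av (of_int (a \<mu>))"
    using dominant_laurent_coeff[OF fin nz] by blast
  \<comment> \<open>Comparison with any other exponent shows that the dominant coefficient is
    nonzero.\<close>
  have "\<mu> + (\<chi> i. 1) \<noteq> \<mu>" by (simp add: Finite_Cartesian_Product.vec_eq_iff)
  from \<mu>[OF this] have "a \<mu> \<noteq> 0" by (metis av_0 av_nonneg leD of_int_0)
  define k where "k = multiplicity (int p) (a \<mu>)"
  have pr: "prime (int p)" using prime_p by simp
  obtain c where c: "a \<mu> = int p ^ k * c" "\<not> int p dvd c"
    using multiplicity_decompose'[of "a \<mu>" "int p"] \<open>a \<mu> \<noteq> 0\<close> pr unfolding k_def by (metis not_prime_unit)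
  \<comment> \<open>A strictly smaller absolute value means at least one more factor
    \<open>p\<close>.\<close>
  have dvd: "int p ^ Suc k dvd a \<nu>" if "\<nu> \<noteq> \<mu>" for \<nu>
  proof (cases "a \<nu> = 0")
    case False
    have "1 / real p ^ multiplicity (int p) (a \<nu>) < 1 / real p ^ k"
      using \<mu>[OF that] av_of_int False \<open>a \<mu> \<noteq> 0\<close> by (simp add: k_def)
    hence "real p ^ k < real p ^ multiplicity (int p) (a \<nu>)"
      using p_pos by (simp add: divide_less_cancel field_simps)
    hence "Suc k \<le> multiplicity (int p) (a \<nu>)" using rp_gt_1 by simp
    thus ?thesis by (rule multiplicity_dvd')
  qed simp
  have "int p ^ Suc k dvd Poly_Mapping.lookup (f - Poly_Mapping.single \<mu> (a \<mu>)) \<nu>" for \<nu>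
    using dvd[of \<nu>] by (cases "\<nu> = \<mu>") (auto simp: lookup_minus lookup lookup_single)
  then obtain h0 where h0: "f - Poly_Mapping.single \<mu> (a \<mu>) = of_int (int p ^ Suc k) * h0"
    using poly_mapping_dvd by blast
  let ?s = "Poly_Mapping.single \<mu> c" and ?M = "2 * (p - 1)"
  have "f = Poly_Mapping.single \<mu> (a \<mu>) + of_int (int p ^ Suc k) * h0"
    using h0 by (simp add: algebra_simps)
  also have "Poly_Mapping.single \<mu> (a \<mu>) = of_nat (p ^ k) * ?s"
    by (simp add: c(1) mult_single flip: single_of_nat)
  also have "\<dots> + of_int (int p ^ Suc k) * h0 = of_nat (p ^ k) * (?s + of_nat p * h0)"
    by (simp add: algebra_simps)
  finally have f: "f ^ ?M = of_nat (p ^ (k * ?M)) * (?s + of_nat p * h0) ^ ?M"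
    by (simp add: power_mult_distrib power_mult)
  obtain h1 where h1: "(?s + of_nat p * h0) ^ ?M = ?s ^ ?M + of_nat p * h1"
    using power_add_mult_dvd by blast
  obtain \<mu>1 where \<mu>1: "?s ^ (p - 1) = Poly_Mapping.single \<mu>1 (c ^ (p - 1))"
    using single_power by blast
  \<comment> \<open>Fermat's little theorem for the natural number \<open>\<bar>c\<bar>\<close>;
    squaring afterwards removes the absolute value.\<close>
  have "[nat \<bar>c\<bar> ^ (p - 1) = 1] (mod p)"
    using prime_p c(2) by (intro fermat_theorem) (auto simp: int_dvd_int_iff[symmetric])
  hence "[int (nat \<bar>c\<bar> ^ (p - 1)) = int 1] (mod int p)" by (simp only: cong_int_iff)
  hence "[\<bar>c\<bar> ^ (p - 1) = 1] (mod int p)" by simp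
  hence "[(\<bar>c\<bar> ^ (p - 1)) ^ 2 = 1 ^ 2] (mod int p)" by (rule cong_pow)
  hence "[c ^ ?M = 1] (mod int p)"
    by (simp add: power_mult[symmetric] mult.commute[of 2] power_even_abs)
  then obtain c' where c': "c ^ ?M = 1 + int p * c'"
    by (metis add.commute cong_iff_lin cong_sym)
  define S where "S = Poly_Mapping.single \<mu>1 (1::int)"
  define S' where "S' = Poly_Mapping.single (- \<mu>1) (1::int)"
  have SS': "S * S' = 1" by (simp add: S_def S'_def mult_single)
  have "?s ^ ?M = (Poly_Mapping.single \<mu>1 (c ^ (p - 1))) ^ 2"
    unfolding \<mu>1[symmetric] by (simp add: power_mult[symmetric] mult.commute)
  also have "Poly_Mapping.single \<mu>1 (c ^ (p - 1)) = S * of_int (c ^ (p - 1))"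
    unfolding S_def single_of_int[symmetric] mult_single by simp
  also have "(S * of_int (c ^ (p - 1))) ^ 2 = S ^ 2 * of_int (c ^ ?M)"
    by (simp add: power_mult_distrib power_mult[symmetric] mult.commute[of 2])
  also have "\<dots> = S ^ 2 * (1 + of_nat p * of_int c')" unfolding c' by simp
  \<comment> \<open>Inserting \<open>(S * S') ^ 2 = 1\<close> lets the unit \<open>S ^ 2\<close> be
    taken out of the second summand too.\<close>
  finally have "?s ^ ?M + of_nat p * h1 = S ^ 2 * (1 + of_nat p * of_int c') + (S * S') ^ 2 * (of_nat p * h1)"
    by (simp add: SS')
  also have "\<dots> = S ^ 2 * (1 + of_nat p * (of_int c' + S' ^ 2 * h1))"
    by (simp add: algebra_simps power_mult_distrib)
  finally have "?s ^ ?M + of_nat p * h1 = S ^ 2 * (1 + of_nat p * (of_int c' + S' ^ 2 * h1))" .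
  hence "f ^ ?M = of_nat (p ^ (k * ?M)) *
      (Poly_Mapping.single \<mu>1 1 ^ 2 * (1 + of_nat p * (of_int c' + S' ^ 2 * h1)))"
    unfolding f h1 S_def by (simp only:)
  thus ?thesis by (intro exI)
qed

section \<open>Limits of coefficient sums and their interchange\<close>

text \<open>The rate is the same for all such sequences; this uniformity later allows the limits in
  \<open>n\<close> and along the subgroups to be interchanged.\<close>

lemma p_adic_limit_of_ints:
  fixes x :: "nat \<Rightarrow> int"
  assumes "\<And>n. int p ^ Suc n dvd x (Suc n) - x n"
  shows "\<exists>L::'k. av_lim av (\<lambda>n. of_int (x n)) L \<and> (\<forall>n. av (L - of_int (x n)) \<le> 1 / real p ^ n)"
proof -
  have step: "av (of_int (x (Suc n)) - of_int (x n)) \<le> 1 / real p ^ n" for n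
  proof -
    have "av (of_int (x (Suc n) - x n)) \<le> 1 / real p ^ Suc n" by (rule av_of_int_dvd[OF assms])
    also have "\<dots> \<le> 1 / real p ^ n" using rp_gt_1 by (intro divide_left_mono power_increasing) auto
    finally show ?thesis by simp
  qed
  obtain L :: 'k where L: "av_lim av (\<lambda>n. of_int (x n)) L"
    using complete[OF av_cauchyI[OF inverse_p_power_tendsto_0 step]] by blast
  have "av (of_int (x j) - of_int (x n)) \<le> 1 / real p ^ n" if "j \<ge> n" for j n
    using that
  proof (induction j rule: dec_induct)
    case (step j)
    have "1 / real p ^ j \<le> 1 / real p ^ n"
      using rp_gt_1 step by (intro divide_left_mono power_increasing) auto
    with \<open>av (of_int (x (Suc j)) - of_int (x j)) \<le> 1 / real p ^ j\<close> step.IH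
    have "av ((of_int (x (Suc j)) - of_int (x j)) + (of_int (x j) - of_int (x n))) \<le> 1 / real p ^ n"
      by (intro order_trans[OF av_add_le]) simp
    thus ?case by simp
  qed simp
  hence "av (L - of_int (x n)) \<le> 1 / real p ^ n" for n
    by (rule av_lim_bounded[OF L])
  with L show ?thesis by blast
qed

text \<open>Choose \<open>n\<close> by the rate, which is uniform in \<open>N\<close>. As
  \<open>e n\<close> has finite support, for large \<open>N\<close> only its coefficient at 0
  contributes to the sum over \<open>T N\<close>.\<close>

lemma limit_along_shrinking_sets:
  fixes e :: "nat \<Rightarrow> 'g::zero \<Rightarrow>\<^sub>0 int" and T :: "nat \<Rightarrow> 'g set" and l :: "nat \<Rightarrow> 'k"
  assumes zero: "\<And>N. 0 \<in> T N"
    and shrink: "\<And>\<nu>. \<nu> \<noteq> 0 \<Longrightarrow> eventually (\<lambda>N. \<nu> \<notin> T N) sequentially"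
    and l: "\<And>N n. av (l N - of_int (linear_extension (\<lambda>\<nu>. of_bool (\<nu> \<in> T N)) (e n))) \<le> 1 / real p ^ n"
    and l0: "\<And>n. av (l0 - of_int (Poly_Mapping.lookup (e n) 0)) \<le> 1 / real p ^ n"
  shows "av_lim av l l0"
  unfolding av_lim_def
proof (intro allI impI)
  fix \<epsilon> :: real assume "\<epsilon> > 0"
  then obtain n where n: "1 / real p ^ n < \<epsilon>"
    using order_tendstoD(2)[OF inverse_p_power_tendsto_0] by (auto simp: eventually_sequentially)
  have "eventually (\<lambda>N. \<forall>\<nu>\<in>Poly_Mapping.keys (e n) - {0}. \<nu> \<notin> T N) sequentially"
    using shrink by (intro eventually_ball_finite) auto
  then obtain N0 where N0: "\<And>N. N \<ge> N0 \<Longrightarrow> \<forall>\<nu>\<in>Poly_Mapping.keys (e n) - {0}. \<nu> \<notin> T N"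
    by (auto simp: eventually_sequentially)
  show "\<exists>M. \<forall>N\<ge>M. av (l N - l0) < \<epsilon>"
  proof (intro exI allI impI)
    fix N assume "N \<ge> N0"
    hence "\<nu> \<in> T N \<longleftrightarrow> \<nu> = 0" if "\<nu> \<in> Poly_Mapping.keys (e n)" for \<nu>
      using N0[of N] zero[of N] that by auto
    hence "linear_extension (\<lambda>\<nu>. of_bool (\<nu> \<in> T N)) (e n) = Poly_Mapping.lookup (e n) 0"
      unfolding lookup_eq_linear_extension[of "e n" 0]
      unfolding linear_extension_def by (intro sum.cong) simp_all
    hence "av (l N - l0) \<le> 1 / real p ^ n"
      using av_diff_le[of "l N - of_int (Poly_Mapping.lookup (e n) 0)"
          "l0 - of_int (Poly_Mapping.lookup (e n) 0)"] l[of N n] l0[of n] by simp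
    thus "av (l N - l0) < \<epsilon>" using n by simp
  qed
qed

section \<open>Logarithms of determinants and Snirelman averages\<close>

text \<open>With \<open>E\<close> the determinant of \<open>1 + p * h\<close>,
  \<open>E ^ (p ^ n)\<close> is \<open>1 + p ^ n * m * S\<close> modulo \<open>p ^ (2 * n)\<close>,
  where \<open>S\<close> sums the coefficients of \<open>e n\<close> over \<open>H\<close>. Hence
  the difference quotients of \<open>E\<close> are \<open>m * S\<close> up to a multiple of
  \<open>p ^ n\<close>, and the logarithm of \<open>E\<close> is \<open>m * L\<close>. The other
  factors of \<open>det_conv f ^ M\<close> are a power of \<open>p\<close>, on which the branch
  vanishes, and the square of a unit.\<close>

lemma padic_log_det_conv:
  fixes H :: "'g::ab_group_add set" and f h :: "'g \<Rightarrow>\<^sub>0 int"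
  assumes "finite_index_subgroup H m idx rep"
    and M: "M > 0" "even M"
    and f: "f ^ M = of_nat (p ^ k) * (Poly_Mapping.single \<mu> 1 ^ 2 * (1 + of_nat p * h))"
    and e: "\<And>n. (1 + of_nat p * h) ^ (p ^ n) = 1 + of_nat (p ^ n) * e n"
    and L: "av_lim av (\<lambda>n. of_int (linear_extension (\<lambda>\<nu>. of_bool (\<nu> \<in> H)) (e n))) L"
  shows "finite_index_subgroup.det_conv m idx rep f \<noteq> 0"
    and "padic_log p av (of_nat (nat \<bar>finite_index_subgroup.det_conv m idx rep f\<bar>)) / of_nat m
          = L / of_nat M"
proof -
  interpret finite_index_subgroup H m idx rep by fact
  let ?S = "\<lambda>n. linear_extension (\<lambda>\<nu>. of_bool (\<nu> \<in> H)) (e n) :: int"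
  define E where "E = det_conv (1 + of_nat p * h)"
  have dvd: "(int p ^ n)\<^sup>2 dvd E ^ (p ^ n) - (1 + int p ^ n * (int m * ?S n))" for n
    using det_conv_one_plus[of "int p ^ n" "e n"] e[of n]
    by (simp add: E_def det_conv_power[symmetric])
  \<comment> \<open>The determinant congruence with \<open>x = p\<close> puts \<open>E\<close> in
    the disc where \<open>log_series\<close> is controlled.\<close>
  have "int p dvd E - 1"
  proof -
    let ?t = "int m * linear_extension (\<lambda>\<nu>. of_bool (\<nu> \<in> H)) h"
    have "(int p)\<^sup>2 dvd E - (1 + int p * ?t)"
      using det_conv_one_plus[of "int p" h] by (simp add: E_def)
    hence "int p dvd (E - (1 + int p * ?t)) + int p * ?t"
      by (intro dvd_add) (auto simp: power2_eq_square dest: dvd_mult_left)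
    thus ?thesis by simp
  qed
  hence "av (of_int (E - 1)) \<le> 1 / real p ^ 1" by (intro av_of_int_dvd) simp
  also have "\<dots> < 1" using rp_gt_1 by simp
  finally have near: "av (of_int E - 1) < 1" by simp
  have E0: "E \<noteq> 0" using near by auto
  have "av_lim av (\<lambda>n. of_nat m * of_int (?S n)) (of_nat m * L)" by (rule av_lim_cmult[OF L])
  hence "av_lim av (\<lambda>n. (of_int E ^ (p ^ n) - 1) / of_nat (p ^ n)) (of_nat m * L)"
  proof (rule av_lim_perturb[OF _ inverse_p_power_tendsto_0])
    fix n
    obtain r where "E ^ (p ^ n) - (1 + int p ^ n * (int m * ?S n)) = (int p ^ n)\<^sup>2 * r"
      using dvd[of n] by blast
    hence "E ^ (p ^ n) = 1 + int p ^ n * (int m * ?S n) + (int p ^ n)\<^sup>2 * r" by simp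
    hence "(of_int (E ^ (p ^ n)) :: 'k) = of_int (1 + int p ^ n * (int m * ?S n) + (int p ^ n)\<^sup>2 * r)"
      by simp
    hence "of_int E ^ (p ^ n) - 1 = of_nat p ^ n * (of_nat m * of_int (?S n) + of_int (int p ^ n * r) :: 'k)"
      by (simp add: algebra_simps power2_eq_square)
    moreover have "of_nat p ^ n \<noteq> (0::'k)" using of_nat_neq_0[OF p_pos] by simp
    ultimately have "(of_int E ^ (p ^ n) - 1) / of_nat (p ^ n) - of_nat m * of_int (?S n)
        = (of_int (int p ^ n * r) :: 'k)"
      by simp
    thus "av ((of_int E ^ (p ^ n) - 1) / of_nat (p ^ n) - of_nat m * of_int (?S n)) \<le> 1 / real p ^ n"
      using av_of_int_dvd[of n "int p ^ n * r"] by simp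
  qed
  hence log_E: "log_series av (of_int E) = of_nat m * L"
    using av_lim_unique log_series_limit[OF near] by blast
  define D where "D = det_conv f"
  have "D ^ M = det_conv (f ^ M)" by (simp add: D_def det_conv_power)
  also have "\<dots> = (int p ^ k) ^ m * (det_conv (Poly_Mapping.single \<mu> 1) ^ 2 * E)"
    unfolding f using det_conv_of_int[of "int p ^ k"]
    by (simp add: det_conv_mult det_conv_power E_def)
  also have "det_conv (Poly_Mapping.single \<mu> 1) ^ 2 = 1"
    using abs_det_conv_single[of \<mu>] by (metis power2_abs power_one)
  finally have DM: "D ^ M = int p ^ (k * m) * E" by (simp add: power_mult)
  show "det_conv f \<noteq> 0"
    using DM E0 p_pos M unfolding D_def[symmetric] by (auto simp: power_0_left)
  have p0: "of_nat p \<noteq> (0::'k)" using of_nat_neq_0[OF p_pos] .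
  have "(of_nat (nat \<bar>D\<bar>) :: 'k) ^ M = of_int (\<bar>D\<bar> ^ M)" by simp
  also have "\<bar>D\<bar> ^ M = int p ^ (k * m) * E" using DM M(2) by (simp add: power_even_abs)
  finally have quot: "(of_nat (nat \<bar>D\<bar>) :: 'k) ^ M / of_nat p powi int (k * m) = of_int E"
    using p0 by (simp del: of_nat_mult)
  have "padic_log p av (of_nat (nat \<bar>D\<bar>)) = log_series av (of_int E) / of_nat M"
    using padic_log_eqI[of M "of_nat (nat \<bar>D\<bar>)" "int (k * m)"] near M(1) unfolding quot by simp
  thus "padic_log p av (of_nat (nat \<bar>det_conv f\<bar>)) / of_nat m = L / of_nat M"
    using of_nat_neq_0[OF index_pos] by (simp add: log_E D_def)
qed

lemma av_linear_extension_le_1: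
  assumes "\<And>\<nu>. av (\<phi> \<nu>) \<le> 1"
  shows "av (linear_extension \<phi> f) \<le> 1"
  unfolding linear_extension_def
proof (rule av_sum_le)
  fix \<nu>
  show "av (of_int (Poly_Mapping.lookup f \<nu>) * \<phi> \<nu>) \<le> 1"
    unfolding av_mult using av_of_int_le_1 assms by (intro mult_le_one) auto
qed simp

text \<open>Evaluation at a torsion point is a ring homomorphism, so the difference quotients of
  \<open>1 + p * h\<close> there are the values of \<open>e n\<close>. Summed over the torsion
  points, orthogonality leaves the coefficients of \<open>e n\<close> with exponents in
  \<open>N\<int>^d\<close>.\<close>

lemma snirelman_avg_padic_log:
  fixes a :: "int^'d \<Rightarrow> int"
  assumes N: "N > 0" and M: "M > 0"
    and lookup: "Poly_Mapping.lookup f = a"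
    and f: "f ^ M = of_nat (p ^ k) * (Poly_Mapping.single \<mu> 1 ^ 2 * (1 + of_nat p * h))"
    and e: "\<And>n. (1 + of_nat p * h) ^ (p ^ n) = 1 + of_nat (p ^ n) * e n"
    and L: "av_lim av (\<lambda>n. of_int (linear_extension
                (\<lambda>\<nu>. of_bool (\<nu> \<in> {\<nu>. \<forall>i. int N dvd \<nu> $ i})) (e n))) (L :: 'k)"
  shows "snirelman_avg (\<lambda>z. padic_log p av (laurent_eval a z)) N = L / of_nat M"
proof -
  let ?U = "{\<zeta> :: 'k^'d. \<forall>i. (\<zeta> $ i) ^ N = 1}"
  define \<psi> where "\<psi> = (\<lambda>(\<zeta>::'k^'d) (\<nu>::int^'d). \<Prod>i\<in>UNIV. (\<zeta> $ i) powi (\<nu> $ i))"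
  define ev where "ev = (\<lambda>\<zeta>. linear_extension (\<psi> \<zeta>))"
  have p0: "of_nat p \<noteq> (0::'k)" using of_nat_neq_0[OF p_pos] .
  have *: "padic_log p av (laurent_eval a \<zeta>) = log_series av (1 + of_nat p * ev \<zeta> h) / of_nat M \<and>
      av_lim av (\<lambda>n. ev \<zeta> (e n)) (log_series av (1 + of_nat p * ev \<zeta> h))"
    if \<zeta>: "\<zeta> \<in> ?U" for \<zeta>
  proof -
    have nz: "\<zeta> $ i \<noteq> 0" for i
    proof
      assume "\<zeta> $ i = 0"
      moreover have "(\<zeta> $ i) ^ N = 1" using \<zeta> by blast
      ultimately show False using N by (simp add: power_0_left)
    qed
    have \<psi>_add: "\<psi> \<zeta> (\<nu> + \<nu>') = \<psi> \<zeta> \<nu> * \<psi> \<zeta> \<nu>'" for \<nu> \<nu>'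
      using nz by (simp add: \<psi>_def power_int_add prod.distrib)
    have \<psi>_0: "\<psi> \<zeta> 0 = 1" by (simp add: \<psi>_def)
    have \<psi>_N: "\<psi> \<zeta> \<nu> ^ N = 1" for \<nu>
    proof -
      have "((\<zeta> $ i) powi j) ^ N = 1" for i j
      proof -
        have "((\<zeta> $ i) powi j) ^ N = ((\<zeta> $ i) ^ N) powi j"
          by (metis mult.commute power_int_mult power_int_of_nat)
        thus ?thesis using \<zeta> by simp
      qed
      thus ?thesis by (simp add: \<psi>_def prod_power_distrib)
    qed
    have "av (\<zeta> $ i) = 1" for i
    proof (rule power_eq_imp_eq_base)
      show "av (\<zeta> $ i) ^ N = 1 ^ N" using \<zeta> by (simp flip: av_power)
    qed (use N in auto)
    hence av_\<psi>: "av (\<psi> \<zeta> \<nu>) = 1" for \<nu> by (simp add: \<psi>_def av_prod av_powi)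
    have ev_mult: "ev \<zeta> (u * v) = ev \<zeta> u * ev \<zeta> v" for u v
      unfolding ev_def by (rule linear_extension_hom_mult[OF \<psi>_add])
    have ev_power: "ev \<zeta> (u ^ n) = ev \<zeta> u ^ n" for u n
      unfolding ev_def by (rule linear_extension_hom_power[OF \<psi>_add \<psi>_0])
    have ev_one_plus: "ev \<zeta> (1 + of_nat c * u) = 1 + of_nat c * ev \<zeta> u" for c u
      unfolding ev_def by (simp only: linear_extension_add linear_extension_one \<psi>_0 linear_extension_of_nat_mult)
    let ?x = "1 + of_nat p * ev \<zeta> h"
    have near: "av (?x - 1) < 1"
    proof -
      have "av (?x - 1) = (1 / real p) * av (ev \<zeta> h)" by (simp add: av_mult av_p)
      also have "\<dots> \<le> (1 / real p) * 1"
        unfolding ev_def using av_\<psi> by (intro mult_left_mono av_linear_extension_le_1) auto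
      also have "\<dots> < 1" using rp_gt_1 by simp
      finally show ?thesis .
    qed
    have "?x ^ (p ^ n) = 1 + of_nat (p ^ n) * ev \<zeta> (e n)" for n
      using arg_cong[OF e[of n], of "ev \<zeta>"] by (simp only: ev_power ev_one_plus)
    hence "(?x ^ (p ^ n) - 1) / of_nat (p ^ n) = ev \<zeta> (e n)" for n
      using p0 by simp
    hence lim: "av_lim av (\<lambda>n. ev \<zeta> (e n)) (log_series av ?x)"
      using log_series_limit[OF near] by simp
    let ?z = "laurent_eval a \<zeta>"
    have z: "?z = ev \<zeta> f"
      by (simp add: ev_def laurent_eval_def linear_extension_def \<psi>_def lookup keys.rep_eq)
    have single: "ev \<zeta> (Poly_Mapping.single \<mu> 1) = \<psi> \<zeta> \<mu>" by (simp add: ev_def)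
    have of_nat: "ev \<zeta> (of_nat c) = of_nat c" for c
      using linear_extension_of_nat_mult[of "\<psi> \<zeta>" c 1] by (simp add: ev_def \<psi>_0)
    have "?z ^ M = of_nat (p ^ k) * (\<psi> \<zeta> \<mu> ^ 2 * ?x)"
      unfolding z ev_power[symmetric] f by (simp only: of_nat ev_mult ev_power single ev_one_plus)
    \<comment> \<open>The \<open>N\<close>-th power removes the root of unity
      \<open>\<psi> \<zeta> \<mu>\<close>, which need not be close to 1; hence the exponent
      \<open>M * N\<close> for the logarithm.\<close>
    hence "?z ^ (M * N) = of_nat (p ^ k) ^ N * ((\<psi> \<zeta> \<mu> ^ N) ^ 2 * ?x ^ N)"
      by (simp add: power_mult power_mult_distrib) (simp add: mult.commute flip: power_mult)
    hence quot: "?z ^ (M * N) / of_nat p powi int (k * N) = ?x ^ N"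
      using p0 by (simp add: \<psi>_N power_mult del: of_nat_mult)
    have "padic_log p av ?z = log_series av (?x ^ N) / of_nat (M * N)"
      using padic_log_eqI[of "M * N" ?z "int (k * N)"] near_1_power[OF near] M N unfolding quot by simp
    also have "\<dots> = log_series av ?x / of_nat M"
      using of_nat_neq_0[OF N] by (simp add: log_series_power[OF near])
    finally show ?thesis using lim by blast
  qed
  let ?T = "{\<nu>::int^'d. \<forall>i. int N dvd \<nu> $ i}"
  have NN: "(of_nat N :: 'k) ^ CARD('d) \<noteq> 0" using of_nat_neq_0[OF N] by simp
  have sum_ev: "(\<Sum>\<zeta>\<in>?U. ev \<zeta> u)
      = of_nat N ^ CARD('d) * of_int (linear_extension (\<lambda>\<nu>. of_bool (\<nu> \<in> ?T)) u)" for u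
  proof -
    have "(\<Sum>\<zeta>\<in>?U. ev \<zeta> u) = linear_extension (\<lambda>\<nu>. \<Sum>\<zeta>\<in>?U. \<psi> \<zeta> \<nu>) u"
      unfolding ev_def by (rule linear_extension_fun_sum[symmetric])
    also have "\<dots> = of_nat N ^ CARD('d) * linear_extension (\<lambda>\<nu>. of_bool (\<nu> \<in> ?T)) u"
      unfolding \<psi>_def sum_roots_of_unity_vec[OF N] linear_extension_fun_cmult by simp
    also have "linear_extension (\<lambda>\<nu>. of_bool (\<nu> \<in> ?T)) u
        = (of_int (linear_extension (\<lambda>\<nu>. of_bool (\<nu> \<in> ?T)) u) :: 'k)"
      by (simp add: linear_extension_def)
    finally show ?thesis .
  qed
  \<comment> \<open>Two evaluations of the same limit, termwise and through orthogonality, give the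
    sum of the logarithms.\<close>
  have "av_lim av (\<lambda>n. \<Sum>\<zeta>\<in>?U. ev \<zeta> (e n)) (\<Sum>\<zeta>\<in>?U. log_series av (1 + of_nat p * ev \<zeta> h))"
    using * by (intro av_lim_sum) blast
  moreover have "av_lim av (\<lambda>n. \<Sum>\<zeta>\<in>?U. ev \<zeta> (e n)) (of_nat N ^ CARD('d) * L)"
    unfolding sum_ev by (rule av_lim_cmult[OF L])
  ultimately have "(\<Sum>\<zeta>\<in>?U. log_series av (1 + of_nat p * ev \<zeta> h)) = of_nat N ^ CARD('d) * L"
    by (rule av_lim_unique)
  moreover have "(\<Sum>\<zeta>\<in>?U. padic_log p av (laurent_eval a \<zeta>))
      = (\<Sum>\<zeta>\<in>?U. log_series av (1 + of_nat p * ev \<zeta> h)) / of_nat M"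
    unfolding sum_divide_distrib using * by (intro sum.cong) auto
  ultimately show ?thesis unfolding snirelman_avg_def using NN by simp
qed

end

theorem theorem1p7:
  fixes p :: nat and av :: "'k::field \<Rightarrow> real"
    and a :: "int^'d \<Rightarrow> int" and G :: "nat \<Rightarrow> (int^'d) set"
  assumes "prime p"
    and "is_Cp p av"
    and "finite {\<nu>. a \<nu> \<noteq> 0}"
    and "\<forall>z\<in>padic_torus av. laurent_eval a z \<noteq> (0::'k)"
    and "tends_to_zero G"
  shows "(\<forall>n. finite (Fix_sub (G n) (X_f a))) \<and>
         (\<exists>h. av_lim av (\<lambda>n. padic_log p av (of_nat (card (Fix_sub (G n) (X_f a))))
                               / of_nat (sub_index (G n))) h
             \<and> snirelman_integral_is p av (\<lambda>z. padic_log p av (laurent_eval a z)) h)"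
proof -
  interpret Cp_field p av using assms(1,2) by unfold_locales
  define f where "f = Abs_poly_mapping a"
  have lookup: "Poly_Mapping.lookup f = a" using assms(3) by (simp add: f_def)
  define M where "M = 2 * (p - 1)"
  have M: "M > 0" "even M" using p_gt_1 by (auto simp: M_def)
  obtain k \<mu> h where f: "f ^ M = of_nat (p ^ k) * (Poly_Mapping.single \<mu> 1 ^ 2 * (1 + of_nat p * h))"
    using nonvanishing_power_decomposition[OF assms(3,4) lookup] unfolding M_def by blast
  obtain e w where ew: "\<And>n. (1 + of_nat p * h) ^ (p ^ n) = 1 + of_nat (p ^ n) * e n"
      "\<And>n. e (Suc n) = e n + of_nat (p ^ Suc n) * w n"
    using one_plus_power_p_power[of p h] by blast
  define S where "S = (\<lambda>T n. linear_extension (\<lambda>\<nu>. of_bool (\<nu> \<in> T)) (e n) :: int)"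
  \<comment> \<open>One function \<open>l\<close> on all sets of exponents serves the subgroups
    \<open>G n\<close>, the lattices \<open>N\<int>^d\<close> and \<open>{0}\<close> alike, with the
    same rate of convergence.\<close>
  have "\<exists>L::'k. av_lim av (\<lambda>n. of_int (S T n)) L \<and> (\<forall>n. av (L - of_int (S T n)) \<le> 1 / real p ^ n)" for T
    by (rule p_adic_limit_of_ints) (simp only: S_def ew(2) linear_extension_add linear_extension_of_nat_mult, simp)
  then obtain l :: "(int^'d) set \<Rightarrow> 'k" where l: "\<And>T. av_lim av (\<lambda>n. of_int (S T n)) (l T)"
      "\<And>T n. av (l T - of_int (S T n)) \<le> 1 / real p ^ n" by metis
  \<comment> \<open>\<open>l {0}\<close> is the limit of the coefficients at 0; divided by
    \<open>M\<close> it will be the common value of entropy and integral.\<close>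
  have l0: "av (l {0} - of_int (Poly_Mapping.lookup (e n) 0)) \<le> 1 / real p ^ n" for n
    using l(2)[of "{0}" n] by (simp add: S_def lookup_eq_linear_extension)
  have G: "add_subgroup (G n)" "finite (cosets_of (G n))" for n
    using assms(5) by (auto simp: tends_to_zero_def)
  have card_Fix: "finite (Fix_sub (G n) (X_f a)) \<and>
      padic_log p av (of_nat (card (Fix_sub (G n) (X_f a)))) / of_nat (sub_index (G n)) = l (G n) / of_nat M" for n
  proof -
    obtain idx rep where fis: "finite_index_subgroup (G n) (sub_index (G n)) idx rep"
      using finite_index_subgroup_exists[OF G] by blast
    note D = padic_log_det_conv[OF fis M f ew(1) l(1)[unfolded S_def]]
    note F = Fix_sub_card[OF fis G(1) lookup D(1)]
    from F(2) have "card (Fix_sub (G n) (X_f a))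
        = nat \<bar>finite_index_subgroup.det_conv (sub_index (G n)) idx rep f\<bar>" by linarith
    thus ?thesis using F(1) D(2) by simp
  qed
  have "av_lim av (\<lambda>n. l (G n)) (l {0})"
  proof (rule limit_along_shrinking_sets[OF _ _ l(2)[unfolded S_def] l0])
    show "0 \<in> G N" for N using G(1) by (simp add: add_subgroup_def)
    fix \<nu> :: "int^'d" assume "\<nu> \<noteq> 0"
    hence "finite {n. \<nu> \<in> G n}" using assms(5) by (simp add: tends_to_zero_def)
    thus "eventually (\<lambda>n. \<nu> \<notin> G n) sequentially"
      by (simp flip: cofinite_eq_sequentially add: eventually_cofinite)
  qed
  hence 1: "av_lim av (\<lambda>n. padic_log p av (of_nat (card (Fix_sub (G n) (X_f a))))
      / of_nat (sub_index (G n))) (l {0} / of_nat M)"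
    using card_Fix av_lim_divide by simp
  let ?T = "\<lambda>N. {\<nu>::int^'d. \<forall>i. int N dvd \<nu> $ i}"
  have "av_lim av (\<lambda>N. l (?T N)) (l {0})"
  proof (rule limit_along_shrinking_sets[OF _ _ l(2)[unfolded S_def] l0])
    fix \<nu> :: "int^'d" assume "\<nu> \<noteq> 0"
    then obtain i where i: "\<nu> $ i \<noteq> 0" by (auto simp: Finite_Cartesian_Product.vec_eq_iff)
    have "\<nu> \<notin> ?T N" if "N \<ge> Suc (nat \<bar>\<nu> $ i\<bar>)" for N
    proof -
      have "\<not> int N dvd \<nu> $ i" using zdvd_imp_le[of "int N" "\<bar>\<nu> $ i\<bar>"] i that by auto
      thus ?thesis by blast
    qed
    thus "eventually (\<lambda>N. \<nu> \<notin> ?T N) sequentially" by (auto simp: eventually_sequentially)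
  qed simp
  hence lim: "av_lim av (\<lambda>N. l (?T N) / of_nat M) (l {0} / of_nat M)" by (rule av_lim_divide)
  have avg: "snirelman_avg (\<lambda>z. padic_log p av (laurent_eval a z)) N = l (?T N) / of_nat M"
    if "N > 0" for N
    by (rule snirelman_avg_padic_log[OF that M(1) lookup f ew(1) l(1)[unfolded S_def]])
  have "snirelman_integral_is p av (\<lambda>z. padic_log p av (laurent_eval a z)) (l {0} / of_nat M)"
    unfolding snirelman_integral_is_def
  proof (intro allI impI)
    fix \<epsilon> :: real assume "\<epsilon> > 0"
    then obtain N0 where "\<And>N. N \<ge> N0 \<Longrightarrow> av (l (?T N) / of_nat M - l {0} / of_nat M) < \<epsilon>"
      using lim unfolding av_lim_def by blast
    \<comment> \<open>The witness \<open>Suc N0\<close> excludes \<open>N = 0\<close>, to which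
      \<open>avg\<close> does not apply.\<close>
    thus "\<exists>N0. \<forall>N\<ge>N0. coprime N p \<longrightarrow>
        av (snirelman_avg (\<lambda>z. padic_log p av (laurent_eval a z)) N - l {0} / of_nat M) < \<epsilon>"
      using avg by (intro exI[of _ "Suc N0"]) auto
  qed
  with 1 card_Fix show ?thesis by blast
qed

end
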